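(* Let $P(\lambda)=\sum_{j=0}^m\lambda^jA_j\in\mathbb{C}[\lambda]^{n\times n}$ be a regular matrix polynomial, let $B\in\mathbb{C}^{n\times r}$, $C\in\mathbb{C}^{r\times n}$, $D\in\mathbb{C}^{r\times r}$, and let $$\mathcal{S}(\lambda)=\begin{bmatrix}-P(\lambda)&B\\ C&D\end{bmatrix}.$$ Let $\sigma:\{0,1,\ldots,m-1\}\to\{1,2,\ldots,m\}$ be a bijection with consecution-inversion structure sequence $\mathrm{CISS}(\sigma)=(c_1,i_1,\ldots,c_l,i_l)$, and let $L_\sigma(\lambda)=\lambda M_m-M_\sigma$ be the Fiedler pencil of $P(\lambda)$ associated with $\sigma$. Then the pencil $$\mathbb{S}_\sigma(\lambda):=\begin{bmatrix}-L_\sigma(\lambda)&e_m\otimes B\\ e_{m-c_1}^T\otimes C&D\end{bmatrix}\ \text{ if } c_1>0,\qquad \mathbb{S}_\sigma(\lambda):=\begin{bmatrix}-L_\sigma(\lambda)&e_{m-i_1}\otimes B\\ e_m^T\otimes C&D\end{bmatrix}\ \text{ if } c_1=0,$$ is a system linearization of $\mathcal{S}(\lambda)$; that is, $\mathcal{S}(\lambda)$ is strict system equivalent to $\mathbb{S}_\sigma(\lambda)$.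
   Context: A square matrix polynomial is regular if its determinant is not identically zero, and unimodular if its determinant is a nonzero constant. $e_j$ is the $j$-th column of the $m\times m$ identity matrix; $\otimes$ is the Kronecker product. Fiedler matrices of $P$ ($nm\times nm$): $M_0=\mathrm{diag}(I_{(m-1)n},-A_0)$; $M_m=\mathrm{diag}(A_m,I_{(m-1)n})$; and for $i=1,\ldots,m-1$, $M_i=\mathrm{diag}\left(I_{(m-i-1)n},\begin{bmatrix}-A_i&I_n\\ I_n&0\end{bmatrix},I_{(i-1)n}\right)$. For a bijection $\sigma$, $M_\sigma:=M_{\sigma^{-1}(1)}M_{\sigma^{-1}(2)}\cdots M_{\sigma^{-1}(m)}$, and $L_\sigma(\lambda)=\lambda M_m-M_\sigma$. $\sigma$ has a consecution at $d\in\{0,\ldots,m-2\}$ if $\sigma(d)<\sigma(d+1)$ and an inversion at $d$ if $\sigma(d)>\sigma(d+1)$. $\mathrm{CISS}(\sigma)=(c_1,i_1,c_2,i_2,\ldots,c_l,i_l)$ means that $\sigma$ has $c_1$ consecutive consecutions at $0,1,\ldots,c_1-1$, then $i_1$ consecutive inversions at $c_1,\ldots,c_1+i_1-1$, and so on, up to $i_l$ inversions at $m-1-i_l,\ldots,m-2$ (only $c_1$ and $i_l$ may be zero; for $m=1$ the sequence is $(0,0)$). Strict system equivalence. For $k=1,2$ let $\mathcal{S}_k(\lambda)=\begin{bmatrix}A_k(\lambda)&B_k(\lambda)\\ C_k(\lambda)&D_k(\lambda)\end{bmatrix}$ be polynomial matrices with $A_k\in\mathbb{C}[\lambda]^{r_k\times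 r_k}$ regular, $B_k\in\mathbb{C}[\lambda]^{r_k\times s}$, $C_k\in\mathbb{C}[\lambda]^{p\times r_k}$, $D_k\in\mathbb{C}[\lambda]^{p\times s}$, and $n_k=\deg\det A_k(\lambda)$. For $q\ge\max\{n_1,n_2\}$ (with $q\ge r_1,r_2$) put $\mathcal{S}_k^e(\lambda)=\begin{bmatrix}I_{q-r_k}&0&0\\0&A_k(\lambda)&B_k(\lambda)\\0&C_k(\lambda)&D_k(\lambda)\end{bmatrix}$. Then $\mathcal{S}_1$ and $\mathcal{S}_2$ are strict system equivalent if (for such a $q$) there exist unimodular $U(\lambda),V(\lambda)\in\mathbb{C}[\lambda]^{q\times q}$ and $X(\lambda)\in\mathbb{C}[\lambda]^{p\times q}$, $Y(\lambda)\in\mathbb{C}[\lambda]^{q\times s}$ with $$\begin{bmatrix}U(\lambda)&0\\ X(\lambda)&I_p\end{bmatrix}\mathcal{S}_1^e(\lambda)=\mathcal{S}_2^e(\lambda)\begin{bmatrix}V(\lambda)&Y(\lambda)\\0&I_s\end{bmatrix}.$$ Here the state block of $\mathcal{S}(\lambda)$ is $-P(\lambda)$ (size $n$) and that of $\mathbb{S}_\sigma(\lambda)$ is $-L_\sigma(\lambda)$ (size $nm$). A pencil $\begin{bmatrix}L(\lambda)&X\\ Y&D\end{bmatrix}$ of size $(nm+r)\times(nm+r)$, with $L(\lambda)$ an $nm\times nm$ matrix pencil, is a system linearization of $\mathcal{S}(\lambda)$ if it is strict system equivalent to $\mathcal{S}(\lambda)$. *)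

theory Defs
  imports "Jordan_Normal_Form.Determinant"
begin

section \<open>Matrix polynomials and pencils\<close>

definition regular_poly_mat :: "complex poly mat \<Rightarrow> bool" where
  "regular_poly_mat A \<longleftrightarrow> square_mat A \<and> det A \<noteq> 0"

definition unimodular_poly_mat :: "complex poly mat \<Rightarrow> bool" where
  "unimodular_poly_mat U \<longleftrightarrow> square_mat U \<and> (\<exists>c. c \<noteq> 0 \<and> det U = [:c:])"

definition const_poly_mat :: "complex mat \<Rightarrow> complex poly mat" where
  "const_poly_mat A = map_mat (\<lambda>a. [:a:]) A"

text \<open>The \<open>n\<close> by \<open>n\<close> matrix polynomial with coefficient \<open>A j\<close> at the \<open>j\<close>-th power of the
  indeterminate, \<open>j \<le> m\<close>. The leading coefficient \<open>A m\<close> may vanish or be singular.\<close>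

definition matrix_polynomial :: "nat \<Rightarrow> nat \<Rightarrow> (nat \<Rightarrow> complex mat) \<Rightarrow> complex poly mat" where
  "matrix_polynomial n m A = mat n n (\<lambda>(i, k). \<Sum>j\<le>m. monom (A j $$ (i, k)) j)"

text \<open>\<open>matrix_pencil L1 L0\<close> has leading coefficient \<open>L1\<close> and constant term \<open>L0\<close>.\<close>

definition matrix_pencil :: "complex mat \<Rightarrow> complex mat \<Rightarrow> complex poly mat" where
  "matrix_pencil L1 L0 = [:0, 1:] \<cdot>\<^sub>m const_poly_mat L1 + const_poly_mat L0"

definition kronecker :: "complex mat \<Rightarrow> complex mat \<Rightarrow> complex mat" (infixl "\<otimes>\<^sub>K" 70) where
  "A \<otimes>\<^sub>K B = mat (dim_row A * dim_row B) (dim_col A * dim_col B)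
     (\<lambda>(i, j). A $$ (i div dim_row B, j div dim_col B) * B $$ (i mod dim_row B, j mod dim_col B))"

text \<open>The \<open>j\<close>-th column of the identity, counted from \<open>1\<close>, as an \<open>m\<close> by \<open>1\<close> matrix.\<close>

definition e_col :: "nat \<Rightarrow> nat \<Rightarrow> complex mat" where
  "e_col m j = mat_of_cols m [col (1\<^sub>m m) (j - 1)]"


section \<open>Strict system equivalence\<close>

text \<open>A polynomial matrix \<open>S\<close> of size \<open>r + p\<close> by \<open>r + s\<close> is read as partitioned into a state block
  of size \<open>r\<close> by \<open>r\<close>, an input block, an output block, and a feedthrough block of size \<open>p\<close> by
  \<open>s\<close>. The partition is part of the data, hence the argument \<open>r\<close> throughout.\<close>

definition state_block :: "nat \<Rightarrow> complex poly mat \<Rightarrow> complex poly mat" where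
  "state_block r S = mat r r (\<lambda>(i, j). S $$ (i, j))"

definition is_system_matrix :: "nat \<Rightarrow> nat \<Rightarrow> nat \<Rightarrow> complex poly mat \<Rightarrow> bool" where
  "is_system_matrix p s r S \<longleftrightarrow>
     S \<in> carrier_mat (r + p) (r + s) \<and> regular_poly_mat (state_block r S)"

definition extend_system :: "nat \<Rightarrow> nat \<Rightarrow> complex poly mat \<Rightarrow> complex poly mat" where
  "extend_system q r S = diag_block_mat [1\<^sub>m (q - r), S]"

definition strict_system_equivalent ::
  "nat \<Rightarrow> nat \<Rightarrow> nat \<Rightarrow> complex poly mat \<Rightarrow> nat \<Rightarrow> complex poly mat \<Rightarrow> bool" where
  "strict_system_equivalent p s r1 S1 r2 S2 \<longleftrightarrow>
     is_system_matrix p s r1 S1 \<and> is_system_matrix p s r2 S2 \<and>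
     (\<exists>q U V X Y.
        degree (det (state_block r1 S1)) \<le> q \<and> degree (det (state_block r2 S2)) \<le> q \<and>
        r1 \<le> q \<and> r2 \<le> q \<and>
        U \<in> carrier_mat q q \<and> unimodular_poly_mat U \<and>
        V \<in> carrier_mat q q \<and> unimodular_poly_mat V \<and>
        X \<in> carrier_mat p q \<and> Y \<in> carrier_mat q s \<and>
        four_block_mat U (0\<^sub>m q p) X (1\<^sub>m p) * extend_system q r1 S1 =
        extend_system q r2 S2 * four_block_mat V Y (0\<^sub>m s q) (1\<^sub>m s))"

text \<open>\<open>S\<close> has state block of size \<open>n\<close> and feedthrough block \<open>D\<close>; the linearization \<open>T\<close> has a
  pencil of size \<open>m * n\<close> as state block, and its three other blocks are constant, the last one being
  the same \<open>D\<close>.\<close>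

definition system_linearization ::
  "nat \<Rightarrow> nat \<Rightarrow> nat \<Rightarrow> complex mat \<Rightarrow> complex poly mat \<Rightarrow> complex poly mat \<Rightarrow> bool" where
  "system_linearization m n r D S T \<longleftrightarrow>
     (\<exists>L1 L0 X Y. L1 \<in> carrier_mat (m * n) (m * n) \<and> L0 \<in> carrier_mat (m * n) (m * n) \<and>
        X \<in> carrier_mat (m * n) r \<and> Y \<in> carrier_mat r (m * n) \<and>
        T = four_block_mat (matrix_pencil L1 L0) (const_poly_mat X)
              (const_poly_mat Y) (const_poly_mat D)) \<and>
     strict_system_equivalent r r (m * n) T n S"


section \<open>Fiedler pencils\<close>

definition fiedler_mat :: "nat \<Rightarrow> nat \<Rightarrow> (nat \<Rightarrow> complex mat) \<Rightarrow> nat \<Rightarrow> complex mat" where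
  "fiedler_mat n m A i =
     (if i = 0 then diag_block_mat [1\<^sub>m ((m - 1) * n), - A 0]
      else if i = m then diag_block_mat [A m, 1\<^sub>m ((m - 1) * n)]
      else diag_block_mat
        [1\<^sub>m ((m - i - 1) * n),
         four_block_mat (- A i) (1\<^sub>m n) (1\<^sub>m n) (0\<^sub>m n n),
         1\<^sub>m ((i - 1) * n)])"

text \<open>The factors are ordered from left to right by increasing position \<open>k\<close> in \<open>{1..m}\<close>.\<close>

definition fiedler_prod ::
  "nat \<Rightarrow> nat \<Rightarrow> (nat \<Rightarrow> complex mat) \<Rightarrow> (nat \<Rightarrow> nat) \<Rightarrow> complex mat" where
  "fiedler_prod n m A \<sigma> =
     foldr (\<lambda>k M. fiedler_mat n m A (the_inv_into {0..<m} \<sigma> k) * M) [1..<Suc m] (1\<^sub>m (m * n))"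

definition fiedler_pencil ::
  "nat \<Rightarrow> nat \<Rightarrow> (nat \<Rightarrow> complex mat) \<Rightarrow> (nat \<Rightarrow> nat) \<Rightarrow> complex poly mat" where
  "fiedler_pencil n m A \<sigma> = matrix_pencil (fiedler_mat n m A m) (- fiedler_prod n m A \<sigma>)"


section \<open>Consecution-inversion structure sequence\<close>

definition consecution_at :: "(nat \<Rightarrow> nat) \<Rightarrow> nat \<Rightarrow> bool" where
  "consecution_at \<sigma> d \<longleftrightarrow> \<sigma> d < \<sigma> (d + 1)"

definition inversion_at :: "(nat \<Rightarrow> nat) \<Rightarrow> nat \<Rightarrow> bool" where
  "inversion_at \<sigma> d \<longleftrightarrow> \<sigma> d > \<sigma> (d + 1)"

text \<open>\<open>is_CISS m \<sigma> [(c\<^sub>1, i\<^sub>1), \<dots>, (c\<^sub>l, i\<^sub>l)]\<close>: starting at \<open>0\<close> and ending at \<open>m - 2\<close>, there are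
  \<open>c\<^sub>1\<close> consecutions, then \<open>i\<^sub>1\<close> inversions, and so on, where only \<open>c\<^sub>1\<close> and \<open>i\<^sub>l\<close> may be zero.
  Here \<open>start k\<close> is the position at which the run of \<open>c\<^sub>k\<^sub>+\<^sub>1\<close> consecutions begins.\<close>

definition is_CISS :: "nat \<Rightarrow> (nat \<Rightarrow> nat) \<Rightarrow> (nat \<times> nat) list \<Rightarrow> bool" where
  "is_CISS m \<sigma> ps \<longleftrightarrow>
     (let start = (\<lambda>k. \<Sum>j<k. fst (ps ! j) + snd (ps ! j)) in
      ps \<noteq> [] \<and> start (length ps) = m - 1 \<and>
      (\<forall>k<length ps.
         (0 < k \<longrightarrow> 0 < fst (ps ! k)) \<and>
         (k + 1 < length ps \<longrightarrow> 0 < snd (ps ! k)) \<and>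
         (\<forall>d\<in>{start k..<start k + fst (ps ! k)}. consecution_at \<sigma> d) \<and>
         (\<forall>d\<in>{start k + fst (ps ! k)..<start (k + 1)}. inversion_at \<sigma> d)))"


section \<open>The system matrix and its Fiedler pencil\<close>

definition poly_system ::
  "nat \<Rightarrow> nat \<Rightarrow> (nat \<Rightarrow> complex mat) \<Rightarrow> complex mat \<Rightarrow> complex mat \<Rightarrow> complex mat
    \<Rightarrow> complex poly mat" where
  "poly_system n m A B C D =
     four_block_mat (- matrix_polynomial n m A) (const_poly_mat B)
       (const_poly_mat C) (const_poly_mat D)"

text \<open>The last two arguments are the first two entries of the consecution-inversion structure
  sequence of \<open>\<sigma>\<close>.\<close>

definition fiedler_system_pencil ::
  "nat \<Rightarrow> nat \<Rightarrow> (nat \<Rightarrow> complex mat) \<Rightarrow> complex mat \<Rightarrow> complex mat \<Rightarrow> complex mat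
    \<Rightarrow> (nat \<Rightarrow> nat) \<Rightarrow> nat \<Rightarrow> nat \<Rightarrow> complex poly mat" where
  "fiedler_system_pencil n m A B C D \<sigma> c1 i1 =
     (if c1 > 0 then
        four_block_mat (- fiedler_pencil n m A \<sigma>) (const_poly_mat (e_col m m \<otimes>\<^sub>K B))
          (const_poly_mat (transpose_mat (e_col m (m - c1)) \<otimes>\<^sub>K C)) (const_poly_mat D)
      else
        four_block_mat (- fiedler_pencil n m A \<sigma>) (const_poly_mat (e_col m (m - i1) \<otimes>\<^sub>K B))
          (const_poly_mat (transpose_mat (e_col m m) \<otimes>\<^sub>K C)) (const_poly_mat D))"

end

(* With the Horner shifts W_d = sum_j x^j A_{d+1+j} (so that W_d = x W_{d+1} + A_{d+1} and
   P = x W_0 + A_0), let F_d be the product of the Fiedler matrices of size d + 1 with indices 0, ..., d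
   in the order given by sigma, and G_d = x diag(W_d, I) - F_d. Then G_{m-1} is the Fiedler pencil and
   G_0 = P. Since M_{d+1} commutes with M_0, ..., M_{d-1}, it can be pulled to the left (inversion at d)
   or to the right (consecution at d) of diag(I, F_d), and one explicit block elimination turns G_{d+1}
   into diag(I, G_d). The elimination of an inversion leaves the output block row alone, and moves the
   input block column only when it sits in the topmost block; a consecution is dual. Hence the input
   block travels upwards exactly along an initial run of inversions and the output block along an
   initial run of consecutions, which are the positions read off from the CISS. In particular the
   blocks X and Y of the strict system equivalence can be taken to be zero. *)

theory Submission
  imports Defs
begin

section \<open>Block matrices\<close>

text \<open>One formula for \<open>[I 0]\<close> and for its transpose, according to which dimension
  is larger; for \<open>a = b\<close> it is the identity, so an empty zero block needs no separate
  case.\<close>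

definition rect_one_mat :: "nat \<Rightarrow> nat \<Rightarrow> 'a :: {zero, one} mat" where
  "rect_one_mat a b = mat a b (\<lambda>(i, j). if i = j then 1 else 0)"

lemma rect_one_carrier [simp, intro]: "rect_one_mat a b \<in> carrier_mat a b"
  by (simp add: rect_one_mat_def)

lemma rect_one_dim [simp]: "dim_row (rect_one_mat a b) = a" "dim_col (rect_one_mat a b) = b"
  by (simp_all add: rect_one_mat_def)

lemma rect_one_transpose: "transpose_mat (rect_one_mat a b) = rect_one_mat b a"
  by (auto simp: rect_one_mat_def intro!: eq_matI)

lemma rect_one_mult:
  fixes X :: "'a :: semiring_1 mat"
  assumes "dim_row X = b"
  shows "rect_one_mat a b * X = mat a (dim_col X) (\<lambda>(i, j). if i < b then X $$ (i, j) else 0)"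
proof (rule eq_matI)
  fix i j assume ij: "i < dim_row (mat a (dim_col X) (\<lambda>(i, j). if i < b then X $$ (i, j) else 0))"
    "j < dim_col (mat a (dim_col X) (\<lambda>(i, j). if i < b then X $$ (i, j) else 0))"
  have "(\<Sum>l = 0..<b. (if i = l then 1 else 0) * X $$ (l, j)) = (\<Sum>l = 0..<b. if i = l then X $$ (l, j) else 0)"
    by (rule sum.cong) auto
  then show "(rect_one_mat a b * X) $$ (i, j) =
      mat a (dim_col X) (\<lambda>(i, j). if i < b then X $$ (i, j) else 0) $$ (i, j)"
    using ij by (simp add: rect_one_mat_def scalar_prod_def assms)
qed (simp_all add: assms)

lemma mult_rect_one:
  fixes X :: "'a :: semiring_1 mat"
  assumes "dim_col X = a"
  shows "X * rect_one_mat a b = mat (dim_row X) b (\<lambda>(i, j). if j < a then X $$ (i, j) else 0)"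
proof (rule eq_matI)
  fix i j assume ij: "i < dim_row (mat (dim_row X) b (\<lambda>(i, j). if j < a then X $$ (i, j) else 0))"
    "j < dim_col (mat (dim_row X) b (\<lambda>(i, j). if j < a then X $$ (i, j) else 0))"
  have "(\<Sum>l = 0..<a. X $$ (i, l) * (if l = j then 1 else 0)) = (\<Sum>l = 0..<a. if l = j then X $$ (i, l) else 0)"
    by (rule sum.cong) auto
  then show "(X * rect_one_mat a b) $$ (i, j) =
      mat (dim_row X) b (\<lambda>(i, j). if j < a then X $$ (i, j) else 0) $$ (i, j)"
    using ij by (simp add: rect_one_mat_def scalar_prod_def assms)
qed (simp_all add: assms)

text \<open>Binary block diagonal whose zero blocks are sized by the arguments; this makes
  associativity an unconditional equation.\<close>

definition diag2 :: "'a :: zero mat \<Rightarrow> 'a mat \<Rightarrow> 'a mat" where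
  "diag2 A B = four_block_mat A (0\<^sub>m (dim_row A) (dim_col B)) (0\<^sub>m (dim_row B) (dim_col A)) B"

lemma diag2_carrier [simp, intro]:
  "A \<in> carrier_mat a b \<Longrightarrow> B \<in> carrier_mat c d \<Longrightarrow> diag2 A B \<in> carrier_mat (a + c) (b + d)"
  by (simp add: diag2_def)

lemma diag2_dim [simp]:
  "dim_row (diag2 A B) = dim_row A + dim_row B" "dim_col (diag2 A B) = dim_col A + dim_col B"
  by (simp_all add: diag2_def)

lemma diag2_index [simp]:
  "i < dim_row A + dim_row B \<Longrightarrow> j < dim_col A + dim_col B \<Longrightarrow> diag2 A B $$ (i, j) =
    (if i < dim_row A then if j < dim_col A then A $$ (i, j) else 0
     else if j < dim_col A then 0 else B $$ (i - dim_row A, j - dim_col A))"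
  by (simp add: diag2_def)

lemma diag2_mult:
  fixes A B C D :: "'a :: semiring_0 mat"
  assumes "A \<in> carrier_mat a b" "B \<in> carrier_mat c d" "C \<in> carrier_mat b e" "D \<in> carrier_mat d f"
  shows "diag2 A B * diag2 C D = diag2 (A * C) (B * D)"
  unfolding diag2_def using assms
  by (subst mult_four_block_mat[where ?nr1.0 = a and ?n1.0 = b and ?nr2.0 = c and ?n2.0 = d
        and ?nc1.0 = e and ?nc2.0 = f]) auto

lemma diag2_assoc: "diag2 A (diag2 B C) = diag2 (diag2 A B) C"
  unfolding diag2_def by (rule assoc_four_block_mat)

lemma diag2_one [simp]: "diag2 (1\<^sub>m a) (1\<^sub>m b) = 1\<^sub>m (a + b)"
  by (simp add: diag2_def)

section \<open>Matrix algebra with dimension equations as premises, for use in rewriting\<close>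

lemma zero_mat_simps:
  fixes A :: "'a :: semiring_0 mat"
  shows "dim_row A = r \<Longrightarrow> dim_col A = k \<Longrightarrow> 0\<^sub>m r k + A = A"
    and "dim_row A = r \<Longrightarrow> dim_col A = k \<Longrightarrow> A + 0\<^sub>m r k = A"
    and "dim_col A = r \<Longrightarrow> A * 0\<^sub>m r k = 0\<^sub>m (dim_row A) k"
    and "dim_row A = k \<Longrightarrow> 0\<^sub>m r k * A = 0\<^sub>m r (dim_col A)"
  by (auto intro!: eq_matI)

lemma uminus_zero_mat [simp]: "- 0\<^sub>m r k = (0\<^sub>m r k :: 'a :: group_add mat)"
  by (auto intro!: eq_matI)

lemma one_mat_simps:
  fixes A :: "'a :: semiring_1 mat"
  shows "dim_col A = r \<Longrightarrow> A * 1\<^sub>m r = A"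
    and "dim_row A = r \<Longrightarrow> 1\<^sub>m r * A = A"
  by (auto intro!: eq_matI)

lemma mult_add_distrib_dim:
  fixes A B C :: "'a :: semiring_0 mat"
  shows "dim_row B = dim_row C \<Longrightarrow> dim_col B = dim_col C \<Longrightarrow> dim_col A = dim_row B \<Longrightarrow> A * (B + C) = A * B + A * C"
   and "dim_row B = dim_row C \<Longrightarrow> dim_col B = dim_col C \<Longrightarrow> dim_col B = dim_row A \<Longrightarrow> (B + C) * A = B * A + C * A"
   by (auto intro!: mult_add_distrib_mat add_mult_distrib_mat)

lemma assoc_mult_dim:
  fixes A B C :: "'a :: semiring_0 mat"
  assumes "dim_col A = dim_row B" "dim_col B = dim_row C"
  shows "A * B * C = A * (B * C)"
  using assms assoc_mult_mat[of A "dim_row A" "dim_col A" B "dim_col B" C "dim_col C"]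
  by (metis carrier_matI)

lemma mult_smult_dim:
  fixes A B :: "'a :: comm_ring_1 mat"
  assumes "dim_col A = dim_row B"
  shows "A * (x \<cdot>\<^sub>m B) = x \<cdot>\<^sub>m (A * B)" "(x \<cdot>\<^sub>m A) * B = x \<cdot>\<^sub>m (A * B)"
  using assms mult_smult_distrib[of A "dim_row A" "dim_col A" B "dim_col B" x]
   mult_smult_assoc_mat[of A "dim_row A" "dim_col A" B "dim_col B" x]
  by (metis carrier_matI)+

lemma mult_four_block_dim:
  fixes A1 :: "'a :: semiring_0 mat"
  assumes "dim_row B1 = dim_row A1" "dim_col C1 = dim_col A1" "dim_row D1 = dim_row C1" "dim_col D1 = dim_col B1"
    "dim_row A2 = dim_col A1" "dim_row B2 = dim_col A1" "dim_row C2 = dim_col B1" "dim_row D2 = dim_col B1"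
    "dim_col C2 = dim_col A2" "dim_col D2 = dim_col B2"
  shows "four_block_mat A1 B1 C1 D1 * four_block_mat A2 B2 C2 D2
    = four_block_mat (A1 * A2 + B1 * C2) (A1 * B2 + B1 * D2) (C1 * A2 + D1 * C2) (C1 * B2 + D1 * D2)"
  by (rule mult_four_block_mat[where ?nr1.0 = "dim_row A1" and ?n1.0 = "dim_col A1"
        and ?nr2.0 = "dim_row C1" and ?n2.0 = "dim_col B1" and ?nc1.0 = "dim_col A2" and ?nc2.0 = "dim_col B2"])
    (simp_all only: assms carrier_matI)

lemmas mat_algebra = zero_mat_simps one_mat_simps mult_add_distrib_dim assoc_mult_dim mult_smult_dim
  mult_four_block_dim

section \<open>One elimination step\<close>

text \<open>The intended instance is \<open>J = [I 0]\<close>, \<open>T\<close> its transpose, \<open>R = diag(0, I)\<close> and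
  \<open>Q = diag(W', I)\<close>. Only the product relations below matter, and working with them avoids
  computations with three by three block matrices.\<close>

context
  fixes J T R Q W A W' F K :: "'a :: comm_ring_1 mat" and x :: 'a and n N :: nat
  assumes carr: "J \<in> carrier_mat n N" "T \<in> carrier_mat N n" "R \<in> carrier_mat N N" "Q \<in> carrier_mat N N"
      "W \<in> carrier_mat n n" "A \<in> carrier_mat n n" "F \<in> carrier_mat N N"
    and products: "J * T = 1\<^sub>m n" "J * R = 0\<^sub>m n N" "R * T = 0\<^sub>m N n" "T * J + R = 1\<^sub>m N"
      "Q * T = T * W'" "Q * R = R"
    and W': "W' = x \<cdot>\<^sub>m W + A"
    and K: "K = four_block_mat (- A) J T R"
begin

private lemma dims [simp]:
  "dim_row J = n" "dim_col J = N" "dim_row T = N" "dim_col T = n" "dim_row R = N" "dim_col R = N"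
  "dim_row Q = N" "dim_col Q = N" "dim_row W = n" "dim_col W = n" "dim_row A = n" "dim_col A = n"
  "dim_row F = N" "dim_col F = N" "dim_row W' = n" "dim_col W' = n"
  using carr unfolding W' carrier_mat_def by simp_all

private lemma assoc_products:
  "dim_row X = n \<Longrightarrow> J * (T * X) = X" "dim_row X = N \<Longrightarrow> J * (R * X) = 0\<^sub>m n (dim_col X)"
  "dim_row X = N \<Longrightarrow> Q * (R * X) = R * X"
  by (simp_all add: assoc_mult_dim[symmetric] products mat_algebra(1-6) del: assoc_mult_mat)

private lemma split_one:
  assumes "dim_row X = N" "i < N" "j < dim_col X"
  shows "(T * (J * X)) $$ (i, j) + (R * X) $$ (i, j) = X $$ (i, j)"
proof -
  have "T * (J * X) + R * X = (T * J + R) * X"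
    using assms by (simp add: mat_algebra)
  also have "\<dots> = X" using assms by (simp add: products mat_algebra)
  finally have "(T * (J * X) + R * X) $$ (i, j) = X $$ (i, j)" by simp
  then show ?thesis using assms by (simp del: index_mult_mat(1))
qed

text \<open>\<open>K\<close> contributes \<open>- A\<close> to the upper left block, where it
  combines with the term in \<open>W\<close> to give the next Horner shift
  \<open>W'\<close>.\<close>

lemma inversion_product:
  "- (x \<cdot>\<^sub>m diag2 W (1\<^sub>m N) - K * diag2 (1\<^sub>m n) F) = four_block_mat (- W') (J * F) T (R * F + (- x) \<cdot>\<^sub>m 1\<^sub>m N)"
proof -
  have "K * diag2 (1\<^sub>m n) F = four_block_mat (- A) (J * F) T (R * F)"
    unfolding K diag2_def[of "1\<^sub>m n"] by (simp add: mat_algebra)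
  then show ?thesis
    by (auto simp: W' simp del: index_mult_mat(1) intro!: eq_matI)
qed

lemma consecution_product:
  "- (x \<cdot>\<^sub>m diag2 W (1\<^sub>m N) - diag2 (1\<^sub>m n) F * K) = four_block_mat (- W') J (F * T) (F * R + (- x) \<cdot>\<^sub>m 1\<^sub>m N)"
proof -
  have "diag2 (1\<^sub>m n) F * K = four_block_mat (- A) J (F * T) (F * R)"
    unfolding K diag2_def[of "1\<^sub>m n"] by (simp add: mat_algebra)
  then show ?thesis
    by (auto simp: W' simp del: index_mult_mat(1) intro!: eq_matI)
qed

text \<open>The relation \<open>J * T = I\<close> creates a pivot, \<open>Q * T = T * W'\<close>
  clears the block below it, and \<open>T * J + R = I\<close> with \<open>Q * R = R\<close> leaves
  \<open>F - x Q\<close>. What remains beside the pivot, \<open>- x J\<close>, becomes the right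
  factor.\<close>

lemma inversion_step:
  "four_block_mat (0\<^sub>m n n) J T Q * - (x \<cdot>\<^sub>m diag2 W (1\<^sub>m N) - K * diag2 (1\<^sub>m n) F) =
   diag2 (1\<^sub>m n) (- (x \<cdot>\<^sub>m Q - F)) * four_block_mat (1\<^sub>m n) ((- x) \<cdot>\<^sub>m J) (0\<^sub>m N n) (1\<^sub>m N)"
proof -
  have 1: "J * (R * F + (- x) \<cdot>\<^sub>m 1\<^sub>m N) = (- x) \<cdot>\<^sub>m J"
    by (simp add: mat_algebra assoc_products)
  have 2: "- (T * W') + T * W' = 0\<^sub>m N n"
    by (auto intro!: eq_matI simp del: index_mult_mat(1))
  have 3: "T * (J * F) + Q * (R * F + (- x) \<cdot>\<^sub>m 1\<^sub>m N) = - (x \<cdot>\<^sub>m Q - F)"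
    by (intro eq_matI)
      (simp_all add: mat_algebra assoc_products split_one[of F, symmetric] del: index_mult_mat(1))
  show ?thesis
    unfolding inversion_product unfolding diag2_def[of "1\<^sub>m n"]
    by (subst (1 2) mult_four_block_dim; (simp; fail)?)
      (rule cong_four_block_mat; simp add: 1 2 3 products zero_mat_simps one_mat_simps)
qed

text \<open>Adding \<open>x T\<close> times the first block row turns the lower blocks into
  \<open>(F - x Q) * T\<close> and \<open>(F - x Q) * R\<close>, so the smaller pencil splits off on
  the left.\<close>

lemma consecution_step:
  "four_block_mat (1\<^sub>m n) (0\<^sub>m n N) (x \<cdot>\<^sub>m T) (1\<^sub>m N) * - (x \<cdot>\<^sub>m diag2 W (1\<^sub>m N) - diag2 (1\<^sub>m n) F * K) =
   diag2 (1\<^sub>m n) (- (x \<cdot>\<^sub>m Q - F)) * four_block_mat (- W') J T R"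
proof -
  have 1: "(- (x \<cdot>\<^sub>m Q - F)) * T = (x \<cdot>\<^sub>m T) * (- W') + F * T"
  proof -
    have "(- (x \<cdot>\<^sub>m Q - F)) = (- x) \<cdot>\<^sub>m Q + F" by (intro eq_matI) auto
    then show ?thesis using products(5)
      by (auto simp: mat_algebra simp del: index_mult_mat(1) intro!: eq_matI)
  qed
  have 2: "(- (x \<cdot>\<^sub>m Q - F)) * R = (x \<cdot>\<^sub>m T) * J + (F * R + (- x) \<cdot>\<^sub>m 1\<^sub>m N)"
  proof -
    have *: "(- (x \<cdot>\<^sub>m Q - F)) = (- x) \<cdot>\<^sub>m Q + F" by (intro eq_matI) auto
    \<comment> \<open>Entrywise \<open>T * J + R = I\<close>, which trades \<open>- x R\<close> for
      \<open>x T J - x I\<close>.\<close>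
    have "(T * J) $$ (i, j) + R $$ (i, j) = 1\<^sub>m N $$ (i, j)" if "i < N" "j < N" for i j
      using that arg_cong[OF products(4), of "\<lambda>M. M $$ (i, j)"] by (simp del: index_mult_mat(1) index_one_mat(1))
    then show ?thesis using products(6) unfolding *
      by (auto simp: mat_algebra algebra_simps simp del: index_mult_mat(1) index_one_mat(1) intro!: eq_matI)
        (metis distrib_left)
  qed
  show ?thesis
    unfolding consecution_product unfolding diag2_def[of "1\<^sub>m n"]
    by (subst (1 2) mult_four_block_dim; (simp; fail)?)
      (rule cong_four_block_mat; simp add: 1 2 products zero_mat_simps one_mat_simps)
qed

text \<open>The left factor of \<open>inversion_step\<close> is inverse to the right factor of
  \<open>consecution_step\<close>, so a single product shows both unimodular.\<close>

lemma elimination_inverse: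
  "four_block_mat (0\<^sub>m n n) J T Q * four_block_mat (- W') J T R = 1\<^sub>m (n + N)"
proof -
  have 2: "- (T * W') + T * W' = 0\<^sub>m N n"
    by (auto intro!: eq_matI simp del: index_mult_mat(1))
  show ?thesis
    by (subst mult_four_block_dim; (simp; fail)?)
      (simp add: 2 products zero_mat_simps one_mat_simps)
qed

end

section \<open>Unimodular matrices and block columns\<close>

text \<open>The determinants multiply to 1, and the units among complex polynomials are the nonzero
  constants.\<close>

lemma unimodular_of_right_inverse:
  assumes "U \<in> carrier_mat N N" "V \<in> carrier_mat N N" "U * V = 1\<^sub>m N"
  shows "unimodular_poly_mat U" "unimodular_poly_mat V"
proof -
  have "det U * det V = 1"
    using assms det_mult[of U N V] by simp
  then have "det U dvd 1" "det V dvd 1" by (metis dvd_triv_left, metis dvd_triv_right)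
  then show "unimodular_poly_mat U" "unimodular_poly_mat V"
    using assms by (auto simp: unimodular_poly_mat_def is_unit_poly_iff)
qed

text \<open>A nonzero constant determinant can be divided out of the adjugate without leaving the
  polynomials.\<close>

lemma unimodular_inverse:
  assumes "U \<in> carrier_mat N N" "unimodular_poly_mat U"
  obtains V where "V \<in> carrier_mat N N" "unimodular_poly_mat V" "U * V = 1\<^sub>m N" "V * U = 1\<^sub>m N"
proof -
  from assms obtain c where c: "c \<noteq> 0" "det U = [:c:]" by (auto simp: unimodular_poly_mat_def)
  define V where "V = [:1 / c:] \<cdot>\<^sub>m adj_mat U"
  note adj = adj_mat[OF assms(1)]
  have V: "V \<in> carrier_mat N N" using adj by (simp add: V_def)
  have UV: "U * V = 1\<^sub>m N" and VU: "V * U = 1\<^sub>m N"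
    using adj c assms(1) by (auto simp: V_def mult_smult_dim intro!: eq_matI)
  then show ?thesis
    using that V unimodular_of_right_inverse[OF assms(1) V] by blast
qed

lemma unimodular_mult:
  assumes "U \<in> carrier_mat N N" "V \<in> carrier_mat N N" "unimodular_poly_mat U" "unimodular_poly_mat V"
  shows "unimodular_poly_mat (U * V)"
proof -
  from assms obtain c d where "c \<noteq> 0" "det U = [:c:]" "d \<noteq> 0" "det V = [:d:]"
    by (auto simp: unimodular_poly_mat_def)
  then have "c * d \<noteq> 0 \<and> det (U * V) = [:c * d:]" using assms by (simp add: det_mult)
  then show ?thesis using assms unfolding unimodular_poly_mat_def by auto
qed

lemma unimodular_upper:
  assumes "M \<in> carrier_mat n N"
  shows "unimodular_poly_mat (four_block_mat (1\<^sub>m n) M (0\<^sub>m N n) (1\<^sub>m N))"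
proof -
  have "det (four_block_mat (1\<^sub>m n) M (0\<^sub>m N n) (1\<^sub>m N)) = [:1:]"
    using assms by (subst det_four_block_mat_lower_left_zero[of _ n _ N]) auto
  then show ?thesis by (auto simp: unimodular_poly_mat_def intro: exI[of _ 1])
qed

lemma unimodular_lower:
  assumes "M \<in> carrier_mat N n"
  shows "unimodular_poly_mat (four_block_mat (1\<^sub>m n) (0\<^sub>m n N) M (1\<^sub>m N))"
proof -
  have "det (four_block_mat (1\<^sub>m n) (0\<^sub>m n N) M (1\<^sub>m N)) = [:1:]"
    using assms by (subst det_four_block_mat_upper_right_zero[of _ n _ N]) auto
  then show ?thesis by (auto simp: unimodular_poly_mat_def intro: exI[of _ 1])
qed

lemma unimodular_one [simp]: "unimodular_poly_mat (1\<^sub>m N)"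
  by (auto simp: unimodular_poly_mat_def one_pCons intro: exI[of _ 1])

lemma unimodular_diag2_one:
  assumes "U \<in> carrier_mat N N" "unimodular_poly_mat U"
  shows "unimodular_poly_mat (diag2 (1\<^sub>m n) U)"
proof -
  have "det (diag2 (1\<^sub>m n) U) = det U"
    unfolding diag2_def using assms by (subst det_four_block_mat_lower_left_zero[of _ n _ N]) auto
  then show ?thesis using assms by (auto simp: unimodular_poly_mat_def)
qed

section \<open>Stacked rows and block columns\<close>

lemma append_rows_dim [simp]:
  "dim_row (A @\<^sub>r B) = dim_row A + dim_row B" "dim_col (A @\<^sub>r B) = dim_col A"
  by (simp_all add: append_rows_def)

lemma append_rows_index [simp]:
  assumes "i < dim_row A + dim_row B" "j < dim_col A"
  shows "(A @\<^sub>r B) $$ (i, j) = (if i < dim_row A then A $$ (i, j) else B $$ (i - dim_row A, j))"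
  using assms by (simp add: append_rows_def)

lemma four_block_mult_append_rows:
  fixes A :: "'a :: semiring_0 mat"
  assumes "dim_row B = dim_row A" "dim_col C = dim_col A" "dim_row D = dim_row C" "dim_col D = dim_col B"
    "dim_row X = dim_col A" "dim_row Y = dim_col B" "dim_col Y = dim_col X"
  shows "four_block_mat A B C D * (X @\<^sub>r Y) = (A * X + B * Y) @\<^sub>r (C * X + D * Y)"
  unfolding append_rows_def
  by (subst mult_four_block_dim) (auto simp: assms zero_mat_simps intro!: cong_four_block_mat eq_matI)

lemma diag2_transpose: "transpose_mat (diag2 A B) = diag2 (transpose_mat A) (transpose_mat B)"
  by (auto intro!: eq_matI)

text \<open>The block column of height \<open>d + 1\<close> with \<open>B\<close> in block row \<open>b\<close>, counted from \<open>0\<close> at the bottom.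
  Output block rows are handled as transposes of block columns.\<close>

fun block_col :: "nat \<Rightarrow> nat \<Rightarrow> 'a :: zero mat \<Rightarrow> 'a mat" where
  "block_col 0 b B = B"
| "block_col (Suc d) b B =
    (if b = Suc d then B @\<^sub>r 0\<^sub>m (Suc d * dim_row B) (dim_col B)
     else 0\<^sub>m (dim_row B) (dim_col B) @\<^sub>r block_col d b B)"

lemma block_col_dim [simp]:
  "dim_row (block_col d b B) = dim_row B + d * dim_row B" "dim_col (block_col d b B) = dim_col B"
  by (induction d) auto

text \<open>Counted from the top, block row \<open>b\<close> is \<open>d - b\<close>; in this form
  the entries can be compared with those of a Kronecker product.\<close>

lemma block_col_index:
  assumes "b \<le> d" "i < dim_row B + d * dim_row B" "j < dim_col B"
  shows "block_col d b B $$ (i, j) =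
    (if i div dim_row B = d - b then B $$ (i mod dim_row B, j) else 0)"
  using assms
proof (induction d arbitrary: i)
  case (Suc d)
  show ?case
  proof (cases "i < dim_row B")
    case True
    then show ?thesis using Suc.prems by (auto simp: Suc_diff_le)
  next
    case False
    moreover have "0 < dim_row B" using Suc.prems by (cases "dim_row B") auto
    ultimately have *: "i div dim_row B = Suc ((i - dim_row B) div dim_row B)"
      "i mod dim_row B = (i - dim_row B) mod dim_row B"
      by (simp_all add: le_div_geq le_mod_geq)
    show ?thesis
      using Suc False by (auto simp: * Suc_diff_le)
  qed
qed auto

section \<open>Action of the elimination factors on block columns\<close>

context
  fixes B :: "'a :: semiring_1 mat" and n d N :: nat
  assumes B: "dim_row B = n" and N: "N = n + d * n"
begin

lemma rect_one_mult_block_col: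
  assumes "b \<le> d"
  shows "rect_one_mat n N * block_col d b B = (if b = d then B else 0\<^sub>m n (dim_col B))"
  using assms B N by (cases d) (auto simp: rect_one_mult intro!: eq_matI)

lemma rect_one_mult_eq_block_col: "rect_one_mat N n * B = block_col d d B"
  using B N by (cases d) (auto simp: rect_one_mult intro!: eq_matI)

lemma diag2_mult_block_col:
  assumes "b < d" "M \<in> carrier_mat n n"
  shows "diag2 M (1\<^sub>m (d * n)) * block_col d b B = block_col d b B"
  using assms B N unfolding diag2_def
  by (cases d) (auto simp: four_block_mult_append_rows mat_algebra)

lemma diag2_zero_mult_block_col:
  assumes "b \<le> d"
  shows "diag2 (0\<^sub>m n n) (1\<^sub>m (d * n)) * block_col d b B =
    (if b = d then 0\<^sub>m N (dim_col B) else block_col d b B)"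
proof (cases d)
  case 0
  \<comment> \<open>There is a single block here, so the factor degenerates to the zero
    matrix.\<close>
  moreover have "diag2 (0\<^sub>m n n) (1\<^sub>m 0) = (0\<^sub>m n n :: 'a mat)" by (auto intro!: eq_matI)
  ultimately show ?thesis using assms B N by (simp add: zero_mat_simps)
next
  case (Suc e)
  then show ?thesis using assms B N unfolding diag2_def
    by (auto simp: four_block_mult_append_rows mat_algebra intro!: eq_matI)
qed

end

text \<open>Provides the relations assumed in the elimination step, in the same order, for the
  concrete \<open>J\<close>, \<open>T\<close>, \<open>R\<close> and \<open>Q\<close>.\<close>

lemma rect_one_products:
  fixes W :: "'a :: comm_ring_1 mat"
  assumes "W \<in> carrier_mat n n" "N = n + s"
  shows "rect_one_mat n N * rect_one_mat N n = (1\<^sub>m n :: 'a mat)" (is ?A)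
    "rect_one_mat n N * diag2 (0\<^sub>m n n) (1\<^sub>m s) = (0\<^sub>m n N :: 'a mat)" (is ?B)
    "diag2 (0\<^sub>m n n) (1\<^sub>m s) * rect_one_mat N n = (0\<^sub>m N n :: 'a mat)" (is ?C)
    "rect_one_mat N n * rect_one_mat n N + diag2 (0\<^sub>m n n) (1\<^sub>m s) = (1\<^sub>m N :: 'a mat)" (is ?D)
    "diag2 W (1\<^sub>m s) * rect_one_mat N n = rect_one_mat N n * W" (is ?E)
    "diag2 W (1\<^sub>m s) * diag2 (0\<^sub>m n n) (1\<^sub>m s) = diag2 (0\<^sub>m n n) (1\<^sub>m s)" (is ?F)
proof -
  have [simp]: "dim_row W = n" "dim_col W = n" using assms by auto
  show ?A ?B ?C ?D ?E
    unfolding assms(2)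
    by (rule eq_matI; simp add: rect_one_mult mult_rect_one del: index_mult_mat(1); auto simp: rect_one_mat_def)+
  show ?F using assms(1)
    by (simp add: diag2_mult[where a = n and b = n and e = n and c = s and d = s and f = s])
qed

section \<open>Reduction of the pencil\<close>

text \<open>Length of the longest segment of \<open>{0..<d}\<close> starting at 0 on which
  \<open>P\<close> holds. The recursion follows a block through the eliminations: it rises to
  \<open>Suc d\<close> only from the topmost row \<open>d\<close>.\<close>

primrec initial_run :: "(nat \<Rightarrow> bool) \<Rightarrow> nat \<Rightarrow> nat" where
  "initial_run P 0 = 0"
| "initial_run P (Suc d) = (if P d \<and> initial_run P d = d then Suc d else initial_run P d)"

lemma initial_run_le: "initial_run P d \<le> d"
  by (induction d) (auto simp: le_Suc_eq)

lemma initial_run_eq: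
  assumes "\<And>e. e < t \<Longrightarrow> P e" "t < d \<Longrightarrow> \<not> P t" "t \<le> d"
  shows "initial_run P d = t"
  using assms(2,3)
proof (induction d)
  case (Suc d)
  show ?case
  proof (cases "t = Suc d")
    case True
    \<comment> \<open>Up to \<open>t\<close> every position satisfies \<open>P\<close>, so the run
      fills its whole range.\<close>
    have "initial_run P e = e" if "e \<le> t" for e
      using that by (induction e) (auto intro: assms(1))
    from this[of d] this[of "Suc d"] True assms(1)[of d] show ?thesis by simp
  next
    case False
    then have "\<not> P t" "t \<le> d" using Suc.prems by auto
    moreover from this have "initial_run P d = t" using Suc.IH by blast
    ultimately show ?thesis by auto
  qed
qed auto

text \<open>The Fiedler matrix of index \<open>d + 1\<close> in size \<open>d + 2\<close>, cut after
  the first \<open>n\<close> rows and columns to get the shape of \<open>K\<close>. The entries lie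
  in any commutative ring, so that complex and polynomial matrices are both covered.\<close>

definition fiedler_block :: "nat \<Rightarrow> nat \<Rightarrow> 'a :: comm_ring_1 mat \<Rightarrow> 'a mat" where
  "fiedler_block n d A =
    (let N = n + d * n in
     four_block_mat (- A) (rect_one_mat n N) (rect_one_mat N n) (diag2 (0\<^sub>m n n) (1\<^sub>m (d * n))))"

text \<open>The positions \<open>b\<close> and \<open>c\<close> refer to the smaller pencil. In the
  larger one a block sits one row higher only if it was in row \<open>d\<close> and the step is of
  the right kind: an inversion for \<open>B\<close>, a consecution for \<open>C\<close>. The same
  \<open>U\<close> and \<open>V\<close> serve all \<open>B\<close> and \<open>C\<close>.\<close>

lemma block_elimination:
  fixes W A F G :: "complex poly mat" and x :: "complex poly" and n d :: nat
  defines "N \<equiv> n + d * n"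
  defines "W' \<equiv> x \<cdot>\<^sub>m W + A"
  assumes carr: "W \<in> carrier_mat n n" "A \<in> carrier_mat n n" "F \<in> carrier_mat N N"
    and b: "b \<le> d" "c \<le> d"
    and G: "G = x \<cdot>\<^sub>m diag2 W (1\<^sub>m N) -
      (if inversion then fiedler_block n d A * diag2 (1\<^sub>m n) F else diag2 (1\<^sub>m n) F * fiedler_block n d A)"
  obtains U V where "U \<in> carrier_mat (n + N) (n + N)" "V \<in> carrier_mat (n + N) (n + N)"
    "unimodular_poly_mat U" "unimodular_poly_mat V"
    "U * (- G) = diag2 (1\<^sub>m n) (- (x \<cdot>\<^sub>m diag2 W' (1\<^sub>m (d * n)) - F)) * V"
    "\<And>B r. B \<in> carrier_mat n r \<Longrightarrow>
      U * block_col (Suc d) (if inversion \<and> b = d then Suc d else b) B = 0\<^sub>m n r @\<^sub>r block_col d b B"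
    "\<And>C r. C \<in> carrier_mat n r \<Longrightarrow>
      transpose_mat V * (0\<^sub>m n r @\<^sub>r block_col d c C) = block_col (Suc d) (if \<not> inversion \<and> c = d then Suc d else c) C"
proof -
  let ?J = "rect_one_mat n N :: complex poly mat" and ?T = "rect_one_mat N n :: complex poly mat"
  let ?R = "diag2 (0\<^sub>m n n) (1\<^sub>m (d * n)) :: complex poly mat" and ?Q = "diag2 W' (1\<^sub>m (d * n))"
  let ?K = "four_block_mat (- A) ?J ?T ?R"
  have W': "W' \<in> carrier_mat n n" using carr by (simp add: W'_def)
  have dims [simp]: "dim_row W' = n" "dim_col W' = n" "dim_row F = N" "dim_col F = N" "n + d * n = N"
    using W' carr by (auto simp: N_def)
  have carr': "?J \<in> carrier_mat n N" "?T \<in> carrier_mat N n" "?R \<in> carrier_mat N N" "?Q \<in> carrier_mat N N"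
    by (intro carrier_matI; simp)+
  have N: "N = n + d * n" unfolding N_def ..
  \<comment> \<open>The order matches the assumptions of the elimination context; the final
    \<open>refl\<close> fixes \<open>K\<close>.\<close>
  note ctx = carr' carr rect_one_products[OF W' N] W'_def[THEN meta_eq_to_obj_eq] refl
  have K: "fiedler_block n d A = ?K" by (simp add: fiedler_block_def)
  define U1 where "U1 = four_block_mat (0\<^sub>m n n) ?J ?T ?Q"
  define V1 where "V1 = four_block_mat (1\<^sub>m n) ((- x) \<cdot>\<^sub>m ?J) (0\<^sub>m N n) (1\<^sub>m N)"
  define U2 where "U2 = four_block_mat (1\<^sub>m n) (0\<^sub>m n N) (x \<cdot>\<^sub>m ?T) (1\<^sub>m N)"
  define V2 where "V2 = four_block_mat (- W') ?J ?T ?R"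
  have carrUV: "U1 \<in> carrier_mat (n + N) (n + N)" "V1 \<in> carrier_mat (n + N) (n + N)"
     "U2 \<in> carrier_mat (n + N) (n + N)" "V2 \<in> carrier_mat (n + N) (n + N)"
    unfolding U1_def V1_def U2_def V2_def by (intro carrier_matI; simp)+
  \<comment> \<open>This product gives unimodularity of \<open>U1\<close> and \<open>V2\<close>
    together; \<open>V1\<close> and \<open>U2\<close> are block triangular with identity diagonal
    blocks.\<close>
  have "U1 * V2 = 1\<^sub>m (n + N)"
    unfolding U1_def V2_def by (rule elimination_inverse[OF ctx])
  note uni12 = unimodular_of_right_inverse[OF carrUV(1,4) this]
  have uniV1: "unimodular_poly_mat V1" unfolding V1_def by (rule unimodular_upper) auto
  have uniU2: "unimodular_poly_mat U2" unfolding U2_def by (rule unimodular_lower) auto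
  show ?thesis
  proof (cases inversion)
    case True
    show ?thesis
    proof (rule that[of U1 V1])
      show "U1 * (- G) = diag2 (1\<^sub>m n) (- (x \<cdot>\<^sub>m ?Q - F)) * V1"
        unfolding U1_def V1_def G K using True by (simp add: inversion_step[OF ctx])
    next
      fix B :: "complex poly mat" and r assume B: "B \<in> carrier_mat n r"
      then have Bd: "dim_row B = n" "dim_col B = r" by auto
      \<comment> \<open>If \<open>b = d\<close>, the column is \<open>B\<close> above zero, and
        \<open>?T * B\<close> puts \<open>B\<close> on top of the smaller column. Otherwise
        \<open>?J\<close> annihilates the smaller column and \<open>?Q\<close> fixes it, as its top
        block vanishes.\<close>
      show "U1 * block_col (Suc d) (if inversion \<and> b = d then Suc d else b) B = 0\<^sub>m n r @\<^sub>r block_col d b B"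
        using b Bd W' True unfolding U1_def
        by (auto simp: four_block_mult_append_rows rect_one_mult_block_col[OF Bd(1) N]
            rect_one_mult_eq_block_col[OF Bd(1) N] diag2_mult_block_col[OF Bd(1) N] mat_algebra)
    next
      fix C :: "complex poly mat" and r assume C: "C \<in> carrier_mat n r"
      then have Cd: "dim_row C = n" "dim_col C = r" by auto
      have "transpose_mat V1 = four_block_mat (1\<^sub>m n) (0\<^sub>m n N) ((- x) \<cdot>\<^sub>m ?T) (1\<^sub>m N)"
        unfolding V1_def by (auto intro!: eq_matI simp: rect_one_mat_def)
      then show "transpose_mat V1 * (0\<^sub>m n r @\<^sub>r block_col d c C) = block_col (Suc d) (if \<not> inversion \<and> c = d then Suc d else c) C"
        using b Cd True by (auto simp: four_block_mult_append_rows mat_algebra)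
    qed (use carrUV uni12 uniV1 in auto)
  next
    case False
    show ?thesis
    proof (rule that[of U2 V2])
      show "U2 * (- G) = diag2 (1\<^sub>m n) (- (x \<cdot>\<^sub>m ?Q - F)) * V2"
        unfolding U2_def V2_def G K using False by (simp add: consecution_step[OF ctx])
    next
      fix B :: "complex poly mat" and r assume B: "B \<in> carrier_mat n r"
      then have Bd: "dim_row B = n" "dim_col B = r" by auto
      show "U2 * block_col (Suc d) (if inversion \<and> b = d then Suc d else b) B = 0\<^sub>m n r @\<^sub>r block_col d b B"
        using b Bd False unfolding U2_def by (auto simp: four_block_mult_append_rows mat_algebra)
    next
      fix C :: "complex poly mat" and r assume C: "C \<in> carrier_mat n r"
      then have Cd: "dim_row C = n" "dim_col C = r" by auto
      have "transpose_mat V2 = four_block_mat (- transpose_mat W') ?J ?T ?R"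
      proof -
        have "transpose_mat V2 = four_block_mat (transpose_mat (- W')) (transpose_mat ?T) (transpose_mat ?J) (transpose_mat ?R)"
          unfolding V2_def using carr' W' by (intro transpose_four_block_mat) auto
        then show ?thesis
          by (simp add: diag2_transpose transpose_uminus rect_one_transpose)
      qed
      \<comment> \<open>If \<open>c = d\<close>, \<open>?J\<close> copies \<open>C\<close> into the
        new top row and \<open>?R\<close> erases it below; otherwise \<open>?J\<close> gives zero
        and \<open>?R\<close> leaves the column as it is.\<close>
      then show "transpose_mat V2 * (0\<^sub>m n r @\<^sub>r block_col d c C) = block_col (Suc d) (if \<not> inversion \<and> c = d then Suc d else c) C"
        using b Cd False by (auto simp: four_block_mult_append_rows mat_algebra
            rect_one_mult_block_col[OF Cd(1) N] diag2_zero_mult_block_col[OF Cd(1) N])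
    qed (use carrUV uni12 uniU2 in auto)
  qed
qed

text \<open>Induction on the size: the factors for \<open>Suc d\<close> are
  \<open>diag2 (1\<^sub>m n) U * U0\<close> and \<open>diag2 (1\<^sub>m n) V * V0\<close>, with
  \<open>U0\<close> and \<open>V0\<close> from one elimination. Both blocks of the reduced system
  are in row 0, and in the full pencil their rows are the initial runs of inversions and of
  non-inversions.\<close>

lemma block_reduction:
  fixes W A F :: "nat \<Rightarrow> complex poly mat" and x :: "complex poly" and n M :: nat
    and inversion :: "nat \<Rightarrow> bool"
  assumes W: "\<And>d. d \<le> M \<Longrightarrow> W d \<in> carrier_mat n n"
    and A: "\<And>d. d \<le> M \<Longrightarrow> A d \<in> carrier_mat n n"
    and F: "\<And>d. d \<le> M \<Longrightarrow> F d \<in> carrier_mat (n + d * n) (n + d * n)"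
    and W_rec: "\<And>d. d < M \<Longrightarrow> W d = x \<cdot>\<^sub>m W (Suc d) + A (Suc d)"
    and F_0: "F 0 = - A 0"
    and F_rec: "\<And>d. d < M \<Longrightarrow> F (Suc d) =
      (if inversion d then fiedler_block n d (A (Suc d)) * diag2 (1\<^sub>m n) (F d)
       else diag2 (1\<^sub>m n) (F d) * fiedler_block n d (A (Suc d)))"
    and BC: "B \<in> carrier_mat n r" "C \<in> carrier_mat n s"
  assumes "d \<le> M"
  shows "\<exists>U V. U \<in> carrier_mat (n + d * n) (n + d * n) \<and> V \<in> carrier_mat (n + d * n) (n + d * n) \<and>
    unimodular_poly_mat U \<and> unimodular_poly_mat V \<and>
    U * (- (x \<cdot>\<^sub>m diag2 (W d) (1\<^sub>m (d * n)) - F d)) = diag2 (1\<^sub>m (d * n)) (- (x \<cdot>\<^sub>m W 0 + A 0)) * V \<and>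
    U * block_col d (initial_run inversion d) B = block_col d 0 B \<and>
    transpose_mat V * block_col d 0 C = block_col d (initial_run (\<lambda>e. \<not> inversion e) d) C"
  using \<open>d \<le> M\<close>
proof (induction d)
  case 0
  have 1: "diag2 (W 0) (1\<^sub>m (0 * n)) = W 0" "diag2 (1\<^sub>m (0 * n)) (- (x \<cdot>\<^sub>m W 0 + A 0)) = - (x \<cdot>\<^sub>m W 0 + A 0)"
    by (rule eq_matI; simp)+
  have W0: "W 0 \<in> carrier_mat n n" "A 0 \<in> carrier_mat n n" using W[of 0] A[of 0] by simp_all
  \<comment> \<open>The start \<open>F 0 = - A 0\<close> turns the pencil with one block into
    \<open>P\<close> itself.\<close>
  have 2: "- (x \<cdot>\<^sub>m W 0 - F 0) = - (x \<cdot>\<^sub>m W 0 + A 0)"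
    unfolding F_0 using W0 by (intro eq_matI) auto
  have [simp]: "n + 0 * n = n" by simp
  show ?case
  proof (intro exI conjI)
    show "1\<^sub>m n * - (x \<cdot>\<^sub>m diag2 (W 0) (1\<^sub>m (0 * n)) - F 0) = diag2 (1\<^sub>m (0 * n)) (- (x \<cdot>\<^sub>m W 0 + A 0)) * 1\<^sub>m n"
      unfolding 1 2 using W0 by (simp add: one_mat_simps del: mult_0)
  qed (use BC in simp_all)
next
  case (Suc d)
  let ?N = "n + d * n" and ?b = "initial_run inversion" and ?c = "initial_run (\<lambda>e. \<not> inversion e)"
  let ?P = "x \<cdot>\<^sub>m W 0 + A 0" and ?G = "\<lambda>d. x \<cdot>\<^sub>m diag2 (W d) (1\<^sub>m (d * n)) - F d"
  have P: "?P \<in> carrier_mat n n" using W[of 0] A[of 0] by auto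
  from Suc.IH[OF Suc_leD[OF Suc.prems]] obtain U V where UV: "U \<in> carrier_mat ?N ?N" "V \<in> carrier_mat ?N ?N"
    "unimodular_poly_mat U" "unimodular_poly_mat V" and
    G: "U * (- ?G d) = diag2 (1\<^sub>m (d * n)) (- ?P) * V" and
    B: "U * block_col d (?b d) B = block_col d 0 B" and
    C: "transpose_mat V * block_col d 0 C = block_col d (?c d) C"
    by blast
  have "?G (Suc d) = x \<cdot>\<^sub>m diag2 (W (Suc d)) (1\<^sub>m ?N) - (if inversion d then fiedler_block n d (A (Suc d)) * diag2 (1\<^sub>m n) (F d)
       else diag2 (1\<^sub>m n) (F d) * fiedler_block n d (A (Suc d)))"
    using Suc.prems unfolding mult_Suc by (subst F_rec) auto
  then obtain U0 V0 where UV0: "U0 \<in> carrier_mat (n + ?N) (n + ?N)" "V0 \<in> carrier_mat (n + ?N) (n + ?N)"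
    "unimodular_poly_mat U0" "unimodular_poly_mat V0" and
    G0': "U0 * (- ?G (Suc d)) = diag2 (1\<^sub>m n) (- (x \<cdot>\<^sub>m diag2 (x \<cdot>\<^sub>m W (Suc d) + A (Suc d)) (1\<^sub>m (d * n)) - F d)) * V0" and
    B0': "\<And>B r. B \<in> carrier_mat n r \<Longrightarrow>
      U0 * block_col (Suc d) (if inversion d \<and> ?b d = d then Suc d else ?b d) B = 0\<^sub>m n r @\<^sub>r block_col d (?b d) B" and
    C0': "\<And>C s. C \<in> carrier_mat n s \<Longrightarrow>
      transpose_mat V0 * (0\<^sub>m n s @\<^sub>r block_col d (?c d) C) =
        block_col (Suc d) (if \<not> inversion d \<and> ?c d = d then Suc d else ?c d) C"
    by (rule block_elimination[OF W[OF Suc.prems] A[OF Suc.prems] F[OF Suc_leD[OF Suc.prems]]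
          initial_run_le initial_run_le]) (rule that; assumption)
  \<comment> \<open>By the Horner recursion the leading block is \<open>W d\<close>, so the smaller
    pencil is the one of the induction hypothesis.\<close>
  have G0: "U0 * (- ?G (Suc d)) = diag2 (1\<^sub>m n) (- ?G d) * V0"
    using G0' unfolding W_rec[OF Suc_le_lessD[OF Suc.prems], symmetric] .
  \<comment> \<open>The change of position in one elimination is the recursion of
    \<open>initial_run\<close>.\<close>
  have B0: "U0 * block_col (Suc d) (?b (Suc d)) B = 0\<^sub>m n r @\<^sub>r block_col d (?b d) B"
    unfolding initial_run.simps using B0'[OF BC(1)] .
  have C0: "transpose_mat V0 * (0\<^sub>m n s @\<^sub>r block_col d (?c d) C) = block_col (Suc d) (?c (Suc d)) C"
    unfolding initial_run.simps using C0'[OF BC(2)] .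
  have dims [simp]: "dim_row U = ?N" "dim_col U = ?N" "dim_row V = ?N" "dim_col V = ?N"
     "dim_row U0 = n + ?N" "dim_col U0 = n + ?N" "dim_row V0 = n + ?N" "dim_col V0 = n + ?N"
     "dim_row B = n" "dim_col B = r" "dim_row C = n" "dim_col C = s"
    using UV UV0 BC by auto
  have Gd: "?G d \<in> carrier_mat ?N ?N" "?G (Suc d) \<in> carrier_mat (n + ?N) (n + ?N)"
    using F[OF Suc.prems] F[OF Suc_leD[OF Suc.prems]] by (auto intro!: minus_carrier_mat)
  let ?U = "diag2 (1\<^sub>m n) U" and ?V = "diag2 (1\<^sub>m n) V"
  have UVd: "?U \<in> carrier_mat (n + ?N) (n + ?N)" "?V \<in> carrier_mat (n + ?N) (n + ?N)"
    using UV by auto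
  have "?U * U0 * (- ?G (Suc d)) = ?U * (U0 * (- ?G (Suc d)))"
    using Gd UVd UV0 by (intro assoc_mult_mat) auto
  also have "\<dots> = ?U * diag2 (1\<^sub>m n) (- ?G d) * V0"
    unfolding G0 using Gd UVd UV0 by (intro assoc_mult_mat[symmetric]) auto
  also have "?U * diag2 (1\<^sub>m n) (- ?G d) = diag2 (1\<^sub>m n * 1\<^sub>m n) (U * (- ?G d))"
    using Gd UV by (intro diag2_mult) auto
  also have "\<dots> = diag2 (1\<^sub>m n * 1\<^sub>m n) (diag2 (1\<^sub>m (d * n)) (- ?P) * V)" unfolding G ..
  also have "\<dots> = diag2 (1\<^sub>m n) (diag2 (1\<^sub>m (d * n)) (- ?P)) * ?V"
  proof (rule diag2_mult[symmetric, where c = ?N and d = ?N and f = ?N])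
    have "diag2 (1\<^sub>m (d * n)) (- ?P) \<in> carrier_mat (d * n + n) (d * n + n)" using P by auto
    then show "diag2 (1\<^sub>m (d * n)) (- ?P) \<in> carrier_mat ?N ?N" by (simp add: add.commute)
  qed (use UV in auto)
  also have "diag2 (1\<^sub>m n) (diag2 (1\<^sub>m (d * n)) (- ?P)) = diag2 (1\<^sub>m (Suc d * n)) (- ?P)"
    by (simp add: diag2_assoc)
  also have "diag2 (1\<^sub>m (Suc d * n)) (- ?P) * ?V * V0 = diag2 (1\<^sub>m (Suc d * n)) (- ?P) * (?V * V0)"
    using P by (intro assoc_mult_dim) auto
  finally have 1: "?U * U0 * (- ?G (Suc d)) = diag2 (1\<^sub>m (Suc d * n)) (- ?P) * (?V * V0)" .
  have 2: "?U * U0 * block_col (Suc d) (?b (Suc d)) B = block_col (Suc d) 0 B"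
  proof -
    have "?U * U0 * block_col (Suc d) (?b (Suc d)) B = ?U * (0\<^sub>m n r @\<^sub>r block_col d (?b d) B)"
      by (subst assoc_mult_dim) (simp_all add: B0 del: block_col.simps initial_run.simps)
    also have "\<dots> = 0\<^sub>m n r @\<^sub>r block_col d 0 B"
      unfolding diag2_def by (simp add: four_block_mult_append_rows B mat_algebra)
    finally show ?thesis by simp
  qed
  have 3: "transpose_mat (?V * V0) * block_col (Suc d) 0 C = block_col (Suc d) (?c (Suc d)) C"
  proof -
    have "transpose_mat (?V * V0) * block_col (Suc d) 0 C =
        transpose_mat V0 * (diag2 (1\<^sub>m n) (transpose_mat V) * (0\<^sub>m n s @\<^sub>r block_col d 0 C))"
      using UVd UV0 by (simp add: transpose_mult diag2_transpose assoc_mult_dim)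
    also have "diag2 (1\<^sub>m n) (transpose_mat V) * (0\<^sub>m n s @\<^sub>r block_col d 0 C) = 0\<^sub>m n s @\<^sub>r block_col d (?c d) C"
      unfolding diag2_def by (simp add: four_block_mult_append_rows C mat_algebra)
    finally show ?thesis unfolding C0 .
  qed
  show ?case
  proof (intro exI conjI)
    show "?U * U0 \<in> carrier_mat (n + Suc d * n) (n + Suc d * n)" "?V * V0 \<in> carrier_mat (n + Suc d * n) (n + Suc d * n)"
      unfolding mult_Suc by (rule mult_carrier_mat[OF UVd(1) UV0(1)] mult_carrier_mat[OF UVd(2) UV0(2)])+
    show "unimodular_poly_mat (?U * U0)"
      by (rule unimodular_mult[OF UVd(1) UV0(1) unimodular_diag2_one[OF UV(1,3)] UV0(3)])
    show "unimodular_poly_mat (?V * V0)"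
      by (rule unimodular_mult[OF UVd(2) UV0(2) unimodular_diag2_one[OF UV(2,4)] UV0(4)])
  qed (fact 1 2 3)+
qed

section \<open>Products of Fiedler matrices\<close>

lemma const_poly_mat_index [simp]:
  "i < dim_row A \<Longrightarrow> j < dim_col A \<Longrightarrow> const_poly_mat A $$ (i, j) = [:A $$ (i, j):]"
  "dim_row (const_poly_mat A) = dim_row A" "dim_col (const_poly_mat A) = dim_col A"
  by (simp_all add: const_poly_mat_def)

lemma const_poly_mat_carrier [simp]: "const_poly_mat A \<in> carrier_mat a b \<longleftrightarrow> A \<in> carrier_mat a b"
  by (simp add: const_poly_mat_def)

lemma const_poly_mat_mult:
  assumes "dim_col A = dim_row B"
  shows "const_poly_mat (A * B) = const_poly_mat A * const_poly_mat B"
proof -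
  interpret semiring_hom "\<lambda>a :: complex. [:a:]"
    by unfold_locales (auto simp: one_pCons)
  show ?thesis unfolding const_poly_mat_def
    by (rule mat_hom_mult[of A "dim_row A" "dim_col A" B "dim_col B"]) (rule carrier_matI; simp add: assms)+
qed

lemma const_poly_mat_one [simp]: "const_poly_mat (1\<^sub>m k) = 1\<^sub>m k"
  by (rule eq_matI) (auto simp: one_pCons)

lemma const_poly_mat_uminus: "const_poly_mat (- A) = - const_poly_mat A"
  by (rule eq_matI) auto

lemma const_poly_mat_diag2: "const_poly_mat (diag2 A B) = diag2 (const_poly_mat A) (const_poly_mat B)"
  by (rule eq_matI) auto

lemma const_poly_mat_fiedler_block:
  assumes "A \<in> carrier_mat n n"
  shows "const_poly_mat (fiedler_block n d A) = fiedler_block n d (const_poly_mat A)"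
  using assms by (intro eq_matI) (auto simp: fiedler_block_def Let_def rect_one_mat_def one_pCons)

section \<open>Fiedler matrices in consecutive sizes\<close>

lemma diag_block_mat_Cons_eq: "diag_block_mat (A # As) = diag2 A (diag_block_mat As)"
  by (simp add: diag2_def Let_def)

lemma fiedler_mat_carrier:
  assumes "i < k" "A i \<in> carrier_mat n n"
  shows "fiedler_mat n k A i \<in> carrier_mat (k * n) (k * n)"
proof (cases i)
  case 0
  obtain k' where "k = Suc k'" using assms by (cases k) auto
  then show ?thesis using 0 assms by (auto simp: fiedler_mat_def diag_block_mat_Cons_eq
        simp del: diag_block_mat.simps(2) intro!: carrier_matI)
next
  case (Suc i')
  \<comment> \<open>Writing the size as \<open>Suc i + e\<close> removes the truncated
    subtractions.\<close>
  obtain e where "k = Suc i + e" using assms less_iff_Suc_add by auto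
  then show ?thesis using Suc assms by (auto simp: fiedler_mat_def diag_block_mat_Cons_eq algebra_simps
        simp del: diag_block_mat.simps(2) intro!: carrier_matI)
qed

text \<open>The index counts blocks from the bottom, so a larger size only adds an identity block at
  the top. For \<open>i < k\<close> the case of the leading coefficient arises in neither
  size.\<close>

lemma fiedler_mat_Suc:
  assumes "i < k"
  shows "fiedler_mat n (Suc k) A i = diag2 (1\<^sub>m n) (fiedler_mat n k A i)"
proof -
  have "Suc k - i - 1 = Suc (k - i - 1)" using assms by simp
  moreover have "k * n = n + (k - 1) * n" using assms by (cases k) auto
  ultimately show ?thesis using assms
    by (auto simp: fiedler_mat_def diag_block_mat_Cons_eq diag2_assoc simp del: diag_block_mat.simps(2))
qed

text \<open>Two groupings of one matrix: the first isolates the upper two blocks, for commuting with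
  small indices; the second isolates the first block, for the elimination.\<close>

lemma fiedler_mat_last:
  assumes "A (Suc d) \<in> carrier_mat n n"
  shows "fiedler_mat n (Suc (Suc d)) A (Suc d) =
      diag2 (four_block_mat (- A (Suc d)) (1\<^sub>m n) (1\<^sub>m n) (0\<^sub>m n n)) (1\<^sub>m (d * n))"
    and "fiedler_mat n (Suc (Suc d)) A (Suc d) = fiedler_block n d (A (Suc d))"
proof -
  have "diag2 (1\<^sub>m 0) X = X" "diag2 X (0\<^sub>m 0 0) = X" for X :: "complex mat"
    by (rule eq_matI; simp)+
  then show 1: "fiedler_mat n (Suc (Suc d)) A (Suc d) =
      diag2 (four_block_mat (- A (Suc d)) (1\<^sub>m n) (1\<^sub>m n) (0\<^sub>m n n)) (1\<^sub>m (d * n))"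
    by (simp add: fiedler_mat_def diag_block_mat_Cons_eq del: diag_block_mat.simps(2))
  show "fiedler_mat n (Suc (Suc d)) A (Suc d) = fiedler_block n d (A (Suc d))"
    unfolding 1 fiedler_block_def Let_def using assms
    by (intro eq_matI) (auto simp: rect_one_mat_def)
qed

text \<open>The list holds indices rather than positions and the size \<open>k\<close> is separate,
  so that the same list can be read in two consecutive sizes.\<close>

definition fiedler_list_prod :: "nat \<Rightarrow> nat \<Rightarrow> (nat \<Rightarrow> complex mat) \<Rightarrow> nat list \<Rightarrow> complex mat" where
  "fiedler_list_prod n k A is = foldr (\<lambda>i M. fiedler_mat n k A i * M) is (1\<^sub>m (k * n))"

context
  fixes n :: nat and A :: "nat \<Rightarrow> complex mat" and m :: nat
  assumes A: "\<And>i. i < m \<Longrightarrow> A i \<in> carrier_mat n n"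
begin

lemma fiedler_list_prod_carrier:
  assumes "\<forall>i \<in> set is. i < k" "k \<le> m"
  shows "fiedler_list_prod n k A is \<in> carrier_mat (k * n) (k * n)"
  using assms(1)
proof (induction "is")
  case (Cons i "is")
  then show ?case
    using fiedler_mat_carrier[of i k A n] A[of i] assms(2) by (auto simp: fiedler_list_prod_def)
qed (auto simp: fiedler_list_prod_def)

lemma fiedler_list_prod_append:
  assumes "\<forall>i \<in> set is. i < k" "\<forall>j \<in> set js. j < k" "k \<le> m"
  shows "fiedler_list_prod n k A (is @ js) = fiedler_list_prod n k A is * fiedler_list_prod n k A js"
  using assms(1)
proof (induction "is")
  case Nil
  show ?case using fiedler_list_prod_carrier[OF assms(2,3)] by (simp add: fiedler_list_prod_def)
next
  case (Cons i "is")
  have "fiedler_mat n k A i \<in> carrier_mat (k * n) (k * n)"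
    using fiedler_mat_carrier[of i k A n] A[of i] Cons.prems assms(3) by auto
  moreover have "fiedler_list_prod n k A is \<in> carrier_mat (k * n) (k * n)"
    using Cons.prems by (intro fiedler_list_prod_carrier[OF _ assms(3)]) auto
  ultimately show ?case
    using Cons fiedler_list_prod_carrier[OF assms(2,3)]
    by (simp add: fiedler_list_prod_def assoc_mult_mat[of _ "k * n" "k * n" _ "k * n" _ "k * n"])
qed

lemma fiedler_list_prod_Suc:
  assumes "\<forall>i \<in> set is. i < k" "k \<le> m"
  shows "fiedler_list_prod n (Suc k) A is = diag2 (1\<^sub>m n) (fiedler_list_prod n k A is)"
  using assms(1)
proof (induction "is")
  case Nil
  show ?case by (simp add: fiedler_list_prod_def)
next
  case (Cons i "is")
  have 1: "fiedler_mat n k A i \<in> carrier_mat (k * n) (k * n)"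
    using fiedler_mat_carrier[of i k A n] A[of i] Cons.prems assms(2) by auto
  have 2: "fiedler_list_prod n k A is \<in> carrier_mat (k * n) (k * n)"
    using Cons.prems by (intro fiedler_list_prod_carrier[OF _ assms(2)]) auto
  have "fiedler_list_prod n (Suc k) A (i # is) =
      diag2 (1\<^sub>m n) (fiedler_mat n k A i) * diag2 (1\<^sub>m n) (fiedler_list_prod n k A is)"
    using Cons by (simp add: fiedler_list_prod_def fiedler_mat_Suc)
  also have "\<dots> = diag2 (1\<^sub>m n * 1\<^sub>m n) (fiedler_mat n k A i * fiedler_list_prod n k A is)"
    using 1 2 by (intro diag2_mult) auto
  finally show ?case by (simp add: fiedler_list_prod_def)
qed

text \<open>Indices below \<open>d\<close> act on the lower \<open>d\<close> blocks and the index
  \<open>d + 1\<close> on the upper two, so these factors have disjoint supports.\<close>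

lemma fiedler_mat_commute:
  assumes "\<forall>i \<in> set is. i < d" "Suc d < m"
  shows "fiedler_list_prod n (Suc (Suc d)) A is * fiedler_mat n (Suc (Suc d)) A (Suc d) =
    fiedler_mat n (Suc (Suc d)) A (Suc d) * fiedler_list_prod n (Suc (Suc d)) A is"
proof -
  let ?F = "fiedler_list_prod n d A is"
  let ?K = "four_block_mat (- A (Suc d)) (1\<^sub>m n) (1\<^sub>m n) (0\<^sub>m n n)"
  have F: "?F \<in> carrier_mat (d * n) (d * n)"
    using assms by (intro fiedler_list_prod_carrier) auto
  have K: "?K \<in> carrier_mat (n + n) (n + n)" using A[OF assms(2)] by auto
  have "fiedler_list_prod n (Suc (Suc d)) A is = diag2 (1\<^sub>m (n + n)) ?F"
    using assms by (subst fiedler_list_prod_Suc, auto)+ (simp add: diag2_assoc)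
  moreover have "diag2 (1\<^sub>m (n + n)) ?F * diag2 ?K (1\<^sub>m (d * n)) = diag2 ?K (1\<^sub>m (d * n)) * diag2 (1\<^sub>m (n + n)) ?F"
    using F by (simp add: left_mult_one_mat[OF K] right_mult_one_mat[OF K] K diag2_mult[where a = "n + n" and b = "n + n" and c = "d * n" and d = "d * n" and e = "n + n" and f = "d * n"])
  ultimately show ?thesis unfolding fiedler_mat_last(1)[of A, OF A[OF assms(2)]] by simp
qed

text \<open>Only the factor \<open>d\<close> can obstruct moving the factor \<open>d + 1\<close>. If
  \<open>d\<close> stands to its right, all of \<open>ys\<close> lies below \<open>d\<close> and the
  factor moves to the far left; otherwise it moves to the far right.\<close>

lemma fiedler_list_prod_rec:
  assumes d: "Suc d < m" and set: "set (ys @ Suc d # zs) = {0..<Suc (Suc d)}"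
    and dist: "distinct (ys @ Suc d # zs)"
  shows "d \<in> set zs \<Longrightarrow> fiedler_list_prod n (Suc (Suc d)) A (ys @ Suc d # zs) =
      fiedler_block n d (A (Suc d)) * diag2 (1\<^sub>m n) (fiedler_list_prod n (Suc d) A (ys @ zs))"
    and "d \<in> set ys \<Longrightarrow> fiedler_list_prod n (Suc (Suc d)) A (ys @ Suc d # zs) =
      diag2 (1\<^sub>m n) (fiedler_list_prod n (Suc d) A (ys @ zs)) * fiedler_block n d (A (Suc d))"
proof -
  let ?p = "fiedler_list_prod n (Suc (Suc d)) A" and ?K = "fiedler_mat n (Suc (Suc d)) A (Suc d)"
  let ?N = "Suc (Suc d) * n"
  have lt: "\<forall>i \<in> set ys. i < Suc d" "\<forall>i \<in> set zs. i < Suc d"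
    using set dist by (auto simp: set_eq_iff less_Suc_eq)
  then have lt': "\<forall>i \<in> set ys. i < Suc (Suc d)" "\<forall>i \<in> set zs. i < Suc (Suc d)" by auto
  have Y: "?p ys \<in> carrier_mat ?N ?N" and Z: "?p zs \<in> carrier_mat ?N ?N"
    using lt' d by (auto intro!: fiedler_list_prod_carrier simp del: mult_Suc)
  have K: "?K \<in> carrier_mat ?N ?N"
    using A[OF d] by (intro fiedler_mat_carrier) auto
  have split: "?p (ys @ Suc d # zs) = ?p ys * (?K * ?p zs)"
    using fiedler_list_prod_append[of ys "Suc (Suc d)" "Suc d # zs"] lt' d by (simp add: fiedler_list_prod_def)
  have YZ: "?p ys * ?p zs = diag2 (1\<^sub>m n) (fiedler_list_prod n (Suc d) A (ys @ zs))"
    using lt lt' d by (subst fiedler_list_prod_append[symmetric], simp, simp, simp)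
      (rule fiedler_list_prod_Suc, auto)
  note assoc = assoc_mult_mat[of _ ?N ?N _ ?N _ ?N]
  have block: "?K = fiedler_block n d (A (Suc d))" using A[OF d] by (rule fiedler_mat_last(2))
  {
    assume "d \<in> set zs"
    then have "\<forall>i \<in> set ys. i < d" using lt dist by (auto simp: less_Suc_eq)
    then have "?p ys * ?K = ?K * ?p ys" using d by (rule fiedler_mat_commute)
    then have "?p ys * (?K * ?p zs) = ?K * (?p ys * ?p zs)"
      using assoc[OF Y K Z] assoc[OF K Y Z] by simp
    then show "?p (ys @ Suc d # zs) =
      fiedler_block n d (A (Suc d)) * diag2 (1\<^sub>m n) (fiedler_list_prod n (Suc d) A (ys @ zs))"
      unfolding split YZ block .
  }
  {
    assume "d \<in> set ys"
    then have "\<forall>i \<in> set zs. i < d" using lt dist by (auto simp: less_Suc_eq)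
    then have "?p zs * ?K = ?K * ?p zs" using d by (rule fiedler_mat_commute)
    then have "?p ys * (?K * ?p zs) = (?p ys * ?p zs) * ?K"
      using assoc[OF Y Z K] by simp
    then show "?p (ys @ Suc d # zs) =
      diag2 (1\<^sub>m n) (fiedler_list_prod n (Suc d) A (ys @ zs)) * fiedler_block n d (A (Suc d))"
      unfolding split YZ block .
  }
qed

end

section \<open>Strict system equivalence\<close>

text \<open>The elimination leads from the pencil to the system, and the reverse direction is wanted
  too. The triangular factors are invertible over the polynomials, with the same
  \<open>q\<close>.\<close>

lemma strict_system_equivalent_sym:
  assumes "strict_system_equivalent p s r1 S1 r2 S2"
  shows "strict_system_equivalent p s r2 S2 r1 S1"
proof -
  from assms obtain q U V X Y where sys: "is_system_matrix p s r1 S1" "is_system_matrix p s r2 S2"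
    and deg: "degree (det (state_block r1 S1)) \<le> q" "degree (det (state_block r2 S2)) \<le> q"
    and q: "r1 \<le> q" "r2 \<le> q"
    and U: "U \<in> carrier_mat q q" "unimodular_poly_mat U"
    and V: "V \<in> carrier_mat q q" "unimodular_poly_mat V"
    and X: "X \<in> carrier_mat p q" and Y: "Y \<in> carrier_mat q s"
    and eq: "four_block_mat U (0\<^sub>m q p) X (1\<^sub>m p) * extend_system q r1 S1 =
        extend_system q r2 S2 * four_block_mat V Y (0\<^sub>m s q) (1\<^sub>m s)"
    unfolding strict_system_equivalent_def by blast
  from unimodular_inverse[OF U] obtain U' where U': "U' \<in> carrier_mat q q" "unimodular_poly_mat U'" "U' * U = 1\<^sub>m q" .
  from unimodular_inverse[OF V] obtain V' where V': "V' \<in> carrier_mat q q" "unimodular_poly_mat V'" "V * V' = 1\<^sub>m q" .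
  have dims [simp]: "dim_row U = q" "dim_col U = q" "dim_row U' = q" "dim_col U' = q"
    "dim_row V = q" "dim_col V = q" "dim_row V' = q" "dim_col V' = q"
    "dim_row X = p" "dim_col X = q" "dim_row Y = q" "dim_col Y = s"
    using U V U' V' X Y by auto
  define E1 E2 where "E1 = extend_system q r1 S1" and "E2 = extend_system q r2 S2"
  have "dim_row S1 = r1 + p" "dim_col S1 = r1 + s" "dim_row S2 = r2 + p" "dim_col S2 = r2 + s"
    using sys by (auto simp: is_system_matrix_def)
  then have E_dims [simp]: "dim_row E1 = q + p" "dim_col E1 = q + s" "dim_row E2 = q + p" "dim_col E2 = q + s"
    using q by (simp_all add: E1_def E2_def extend_system_def Let_def)
  let ?L = "four_block_mat U (0\<^sub>m q p) X (1\<^sub>m p)" and ?R = "four_block_mat V Y (0\<^sub>m s q) (1\<^sub>m s)"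
  \<comment> \<open>Inverses of the triangular factors; the corner blocks are forced by
    \<open>U' * U = I\<close> and \<open>V * V' = I\<close>.\<close>
  let ?L' = "four_block_mat U' (0\<^sub>m q p) (- (X * U')) (1\<^sub>m p)"
  let ?R' = "four_block_mat V' (- (V' * Y)) (0\<^sub>m s q) (1\<^sub>m s)"
  have "- (X * U') * U + X = 0\<^sub>m p q"
    by (auto simp: assoc_mult_dim U'(3) one_mat_simps intro!: eq_matI)
  then have L: "?L' * ?L = 1\<^sub>m (q + p)"
    by (subst mult_four_block_dim) (simp_all add: U'(3) mat_algebra)
  have "V * - (V' * Y) + Y = 0\<^sub>m q s"
    by (auto simp: assoc_mult_dim[symmetric] V'(3) one_mat_simps intro!: eq_matI simp del: assoc_mult_mat)
  then have R: "?R * ?R' = 1\<^sub>m (q + s)"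
    by (subst mult_four_block_dim) (simp_all add: V'(3) mat_algebra)
  have "?L' * E2 = ?L' * (E2 * (?R * ?R'))" by (simp add: R one_mat_simps)
  also have "\<dots> = ?L' * (?L * E1) * ?R'"
    using eq[folded E1_def E2_def] by (simp add: assoc_mult_dim[symmetric] del: assoc_mult_mat)
  also have "\<dots> = (?L' * ?L) * E1 * ?R'" by (simp add: assoc_mult_dim[symmetric] del: assoc_mult_mat)
  also have "\<dots> = E1 * ?R'" by (simp add: L one_mat_simps)
  finally have "?L' * E2 = E1 * ?R'" .
  moreover have "- (X * U') \<in> carrier_mat p q" "- (V' * Y) \<in> carrier_mat q s"
    using U' V' X Y by auto
  ultimately show ?thesis
    unfolding strict_system_equivalent_def using sys deg q U'(1,2) V'(1,2)
    unfolding E1_def E2_def by blast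
qed

lemma block_col_0_eq: "block_col d 0 B = 0\<^sub>m (d * dim_row B) (dim_col B) @\<^sub>r B"
  by (induction d) (auto intro!: eq_matI)

lemma state_block_four_block_mat:
  "L \<in> carrier_mat k k \<Longrightarrow> state_block k (four_block_mat L b c D) = L"
  by (rule eq_matI) (auto simp: state_block_def)

text \<open>With \<open>q = N\<close> the larger system is not padded and the smaller one receives
  exactly the identity block of size \<open>k\<close>; the blocks \<open>X\<close> and
  \<open>Y\<close> are zero. Comparing determinants yields regularity of \<open>L\<close>.\<close>

lemma strict_system_equivalentI:
  fixes L P :: "complex poly mat"
  assumes L: "L \<in> carrier_mat N N" and P: "P \<in> carrier_mat n n" and N: "N = k + n"
    and det: "det P \<noteq> 0" and deg: "degree (det L) \<le> N"
    and b: "b \<in> carrier_mat N s" and c: "c \<in> carrier_mat p N"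
    and b': "b' \<in> carrier_mat n s" and c': "c' \<in> carrier_mat p n" and D: "D \<in> carrier_mat p s"
    and U: "U \<in> carrier_mat N N" "unimodular_poly_mat U"
    and V: "V \<in> carrier_mat N N" "unimodular_poly_mat V"
    and UL: "U * L = diag2 (1\<^sub>m k) P * V"
    and Ub: "U * b = 0\<^sub>m k s @\<^sub>r b'"
    and cV: "transpose_mat V * (0\<^sub>m k p @\<^sub>r transpose_mat c') = transpose_mat c"
  shows "strict_system_equivalent p s N (four_block_mat L b c D) n (four_block_mat P b' c' D)"
proof -
  note state = state_block_four_block_mat[OF L] state_block_four_block_mat[OF P]
  have dims [simp]: "dim_row L = N" "dim_col L = N" "dim_row P = n" "dim_col P = n"
    "dim_row b = N" "dim_col b = s" "dim_row c = p" "dim_col c = N"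
    "dim_row b' = n" "dim_col b' = s" "dim_row c' = p" "dim_col c' = n" "dim_row D = p" "dim_col D = s"
    "dim_row U = N" "dim_col U = N" "dim_row V = N" "dim_col V = N"
    using assms by auto
  from U obtain u where u: "u \<noteq> 0" "det U = [:u:]" by (auto simp: unimodular_poly_mat_def)
  from V obtain v where v: "v \<noteq> 0" "det V = [:v:]" by (auto simp: unimodular_poly_mat_def)
  have "det (diag2 (1\<^sub>m k) P) = det P"
    unfolding diag2_def using P by (subst det_four_block_mat_lower_left_zero[of _ k _ n]) auto
  moreover have "diag2 (1\<^sub>m k) P \<in> carrier_mat N N" unfolding N using P by auto
  ultimately have dets: "smult u (det L) = smult v (det P)"
    using arg_cong[OF UL, of det] U V L u v by (simp add: det_mult mult.commute)
  then have degs: "degree (det L) = degree (det P)" using u v by (metis degree_smult_eq)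
  have detL: "det L \<noteq> 0" using dets u v det by auto
  have sys: "is_system_matrix p s N (four_block_mat L b c D)" "is_system_matrix p s n (four_block_mat P b' c' D)"
    unfolding is_system_matrix_def state regular_poly_mat_def using det detL L P D by auto
  let ?r = "transpose_mat (0\<^sub>m k p @\<^sub>r transpose_mat c')"
  have ext1: "extend_system N N (four_block_mat L b c D) = four_block_mat L b c D"
    by (auto simp: extend_system_def Let_def intro!: eq_matI)
  have ext2: "extend_system N n (four_block_mat P b' c' D) =
      four_block_mat (diag2 (1\<^sub>m k) P) (0\<^sub>m k s @\<^sub>r b') ?r D"
    by (rule eq_matI) (auto simp: extend_system_def Let_def N)
  \<comment> \<open>The assumption on \<open>c\<close> is about transposes; undoing them gives the
    output row.\<close>
  have rV: "?r * V = c"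
  proof -
    have "transpose_mat (?r * V) = transpose_mat V * (0\<^sub>m k p @\<^sub>r transpose_mat c')"
      using V c' N by (subst transpose_mult[of _ p N _ N]) (auto intro!: carrier_matI)
    then show ?thesis unfolding cV by (metis transpose_transpose)
  qed
  have "four_block_mat U (0\<^sub>m N p) (0\<^sub>m p N) (1\<^sub>m p) * four_block_mat L b c D =
      four_block_mat (U * L) (U * b) c D"
    by (subst mult_four_block_dim) (simp_all add: mat_algebra)
  also have "\<dots> = four_block_mat (diag2 (1\<^sub>m k) P) (0\<^sub>m k s @\<^sub>r b') ?r D * four_block_mat V (0\<^sub>m N s) (0\<^sub>m s N) (1\<^sub>m s)"
    unfolding UL Ub by (subst mult_four_block_dim) (simp_all add: mat_algebra rV N[symmetric])
  finally have "four_block_mat U (0\<^sub>m N p) (0\<^sub>m p N) (1\<^sub>m p) * extend_system N N (four_block_mat L b c D) =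
      extend_system N n (four_block_mat P b' c' D) * four_block_mat V (0\<^sub>m N s) (0\<^sub>m s N) (1\<^sub>m s)"
    unfolding ext1 ext2 .
  then show ?thesis
    unfolding strict_system_equivalent_def state using sys degs deg U V N
    by (metis le_add2 order_refl zero_carrier_mat)
qed

section \<open>Kronecker products as block columns\<close>

lemma const_poly_mat_kronecker_e_col:
  assumes "b \<le> d"
  shows "const_poly_mat (e_col (Suc d) (Suc d - b) \<otimes>\<^sub>K B) = block_col d b (const_poly_mat B)"
proof (rule eq_matI)
  fix i j
  assume "i < dim_row (block_col d b (const_poly_mat B))" "j < dim_col (block_col d b (const_poly_mat B))"
  then have ij: "i < dim_row B + d * dim_row B" "j < dim_col B" by auto
  then have "i div dim_row B < Suc d" by (intro less_mult_imp_div_less) simp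
  \<comment> \<open>\<open>e_col\<close> counts from 1 at the top, so its index
    \<open>Suc d - b\<close> means row \<open>d - b\<close> counted from 0.\<close>
  moreover have "Suc d - b - 1 = d - b" "d - b < Suc d" using assms by auto
  moreover have "0 < dim_row B" using ij by (cases "dim_row B") auto
  ultimately show "const_poly_mat (e_col (Suc d) (Suc d - b) \<otimes>\<^sub>K B) $$ (i, j) =
      block_col d b (const_poly_mat B) $$ (i, j)"
    using ij assms by (auto simp: block_col_index kronecker_def e_col_def mat_of_cols_def)
qed (auto simp: kronecker_def e_col_def)

text \<open>Lets the output row be treated as a block column built from
  \<open>transpose_mat C\<close>.\<close>

lemma transpose_kronecker_e_col:
  "transpose_mat (e_col m j) \<otimes>\<^sub>K C = transpose_mat (e_col m j \<otimes>\<^sub>K transpose_mat C)"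
proof (rule eq_matI)
  fix i k
  assume "i < dim_row (transpose_mat (e_col m j \<otimes>\<^sub>K transpose_mat C))"
    "k < dim_col (transpose_mat (e_col m j \<otimes>\<^sub>K transpose_mat C))"
  then have ik: "i < dim_row C" "k < m * dim_col C" by (auto simp: kronecker_def e_col_def)
  then have "k div dim_col C < m" by (intro less_mult_imp_div_less) simp
  moreover have "0 < dim_col C" using ik by (cases "dim_col C") auto
  ultimately show "(transpose_mat (e_col m j) \<otimes>\<^sub>K C) $$ (i, k) = transpose_mat (e_col m j \<otimes>\<^sub>K transpose_mat C) $$ (i, k)"
    using ik by (simp add: kronecker_def e_col_def)
qed (auto simp: kronecker_def e_col_def)

lemma transpose_const_poly_mat: "transpose_mat (const_poly_mat A) = const_poly_mat (transpose_mat A)"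
  by (rule eq_matI) auto


text \<open>The run of the kind that comes first stops because the next entry of the sequence is
  positive unless \<open>{0..<d}\<close> is used up. For the other kind position 0 already fails, if
  there is one.\<close>

lemma is_CISS_initial_run:
  assumes ciss: "is_CISS m \<sigma> ((c1, i1) # ps)" and m: "m = Suc d"
  shows "c1 > 0 \<Longrightarrow> initial_run (inversion_at \<sigma>) d = 0 \<and> initial_run (\<lambda>e. \<not> inversion_at \<sigma> e) d = c1"
    and "c1 = 0 \<Longrightarrow> initial_run (inversion_at \<sigma>) d = i1 \<and> initial_run (\<lambda>e. \<not> inversion_at \<sigma> e) d = 0"
proof -
  define qs where "qs = (c1, i1) # ps"
  define start where "start = (\<lambda>k. \<Sum>j<k. fst (qs ! j) + snd (qs ! j))"
  have all: "start (length qs) = d"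
    "\<And>k. k < length qs \<Longrightarrow> 0 < k \<Longrightarrow> 0 < fst (qs ! k)"
    "\<And>k. k + 1 < length qs \<Longrightarrow> 0 < snd (qs ! k)"
    "\<And>k e. k < length qs \<Longrightarrow> e \<in> {start k..<start k + fst (qs ! k)} \<Longrightarrow> consecution_at \<sigma> e"
    "\<And>k e. k < length qs \<Longrightarrow> e \<in> {start k + fst (qs ! k)..<start (k + 1)} \<Longrightarrow> inversion_at \<sigma> e"
    using ciss m unfolding is_CISS_def Let_def qs_def[symmetric] start_def[symmetric] by auto
  have start: "start 0 = 0" "start 1 = c1 + i1" by (simp_all add: start_def qs_def)
  have con: "consecution_at \<sigma> e" if "e < c1" for e
    using all(4)[of 0 e] that by (simp add: start qs_def)
  have inversion: "inversion_at \<sigma> e" if "c1 \<le> e" "e < c1 + i1" for e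
    using all(5)[of 0 e] that start by (simp add: qs_def)
  have mono: "start j \<le> start k" if "j \<le> k" for j k
    unfolding start_def using that by (intro sum_mono2) auto
  have le: "c1 + i1 \<le> d" using mono[of 1 "length qs"] all(1) start by (simp add: qs_def)
  \<comment> \<open>A remaining position forces a second pair. The first pair is then not the last,
    so \<open>i1\<close> is positive, and the second pair starts with a consecution.\<close>
  have next_con: "consecution_at \<sigma> (c1 + i1)" and i1: "0 < i1" if "c1 + i1 < d"
  proof -
    have "ps \<noteq> []" using that all(1) start by (auto simp: qs_def)
    then have l: "1 < length qs" by (cases ps) (auto simp: qs_def)
    then show "0 < i1" using all(3)[of 0] by (simp add: qs_def)
    show "consecution_at \<sigma> (c1 + i1)" using all(2)[of 1] all(4)[of 1 "c1 + i1"] l start by simp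
  qed
  have excl: "\<not> (consecution_at \<sigma> e \<and> inversion_at \<sigma> e)" for e
    by (auto simp: consecution_at_def inversion_at_def)
  show "initial_run (inversion_at \<sigma>) d = 0 \<and> initial_run (\<lambda>e. \<not> inversion_at \<sigma> e) d = c1" if "c1 > 0"
  proof
    show "initial_run (inversion_at \<sigma>) d = 0"
      using con[OF that] excl by (intro initial_run_eq) auto
    show "initial_run (\<lambda>e. \<not> inversion_at \<sigma> e) d = c1"
    proof (rule initial_run_eq)
      \<comment> \<open>If \<open>i1 = 0\<close>, then \<open>c1 < d\<close> leaves a position after
        the first pair, which contradicts \<open>i1\<close>.\<close>
      show "\<not> \<not> inversion_at \<sigma> c1" if "c1 < d"
        using inversion[of c1] i1 that le by (cases "i1 = 0") auto
    qed (use con excl le in auto)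
  qed
  show "initial_run (inversion_at \<sigma>) d = i1 \<and> initial_run (\<lambda>e. \<not> inversion_at \<sigma> e) d = 0" if "c1 = 0"
  proof
    show "initial_run (inversion_at \<sigma>) d = i1"
      using inversion next_con excl le that by (intro initial_run_eq) auto
    show "initial_run (\<lambda>e. \<not> inversion_at \<sigma> e) d = 0"
      using inversion[of 0] i1 that by (intro initial_run_eq) auto
  qed
qed

text \<open>\<open>xs\<close> lists the indices by position, so comparing \<open>\<sigma> d\<close>
  with \<open>\<sigma> (Suc d)\<close> decides on which side of \<open>Suc d\<close> the index
  \<open>d\<close> stands. Filtering keeps this order in every size.\<close>

lemma fiedler_list_prod_filter_rec:
  fixes A :: "nat \<Rightarrow> complex mat"
  assumes A: "\<And>i. i < m \<Longrightarrow> A i \<in> carrier_mat n n"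
    and sorted: "sorted_wrt (\<lambda>i j. \<sigma> i < \<sigma> j) xs" and dist: "distinct xs" and set: "set xs = {0..<m}"
    and d: "Suc d < m"
  shows "fiedler_list_prod n (Suc (Suc d)) A (filter (\<lambda>i. i < Suc (Suc d)) xs) =
    (if inversion_at \<sigma> d
     then fiedler_block n d (A (Suc d)) * diag2 (1\<^sub>m n) (fiedler_list_prod n (Suc d) A (filter (\<lambda>i. i < Suc d) xs))
     else diag2 (1\<^sub>m n) (fiedler_list_prod n (Suc d) A (filter (\<lambda>i. i < Suc d) xs)) * fiedler_block n d (A (Suc d)))"
proof -
  let ?ys = "filter (\<lambda>i. i < Suc (Suc d)) xs"
  have "Suc d \<in> set ?ys" using set d by auto
  then obtain us vs where split: "?ys = us @ Suc d # vs" by (meson split_list)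
  have ys: "set (us @ Suc d # vs) = {0..<Suc (Suc d)}" "distinct (us @ Suc d # vs)"
    "sorted_wrt (\<lambda>i j. \<sigma> i < \<sigma> j) (us @ Suc d # vs)"
    unfolding split[symmetric] using set d dist sorted by (auto simp: sorted_wrt_filter)
  have "filter (\<lambda>i. i < Suc d) xs = filter (\<lambda>i. i < Suc d) ?ys"
    by (auto intro: filter_cong)
  also have "\<dots> = us @ vs"
  proof -
    have "\<forall>i \<in> set us. i < Suc d" "\<forall>i \<in> set vs. i < Suc d"
      using ys(1,2) by (auto simp: set_eq_iff less_Suc_eq)
    then show ?thesis unfolding split by simp
  qed
  finally have filter: "filter (\<lambda>i. i < Suc d) xs = us @ vs" .
  have "d \<in> set (us @ Suc d # vs)" unfolding ys(1) by simp
  then have "d \<in> set us \<or> d \<in> set vs" by auto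
  moreover have "\<sigma> d < \<sigma> (Suc d)" if "d \<in> set us" using ys(3) that by (auto simp: sorted_wrt_append)
  moreover have "\<sigma> (Suc d) < \<sigma> d" if "d \<in> set vs" using ys(3) that by (auto simp: sorted_wrt_append)
  ultimately show ?thesis
    unfolding split filter using fiedler_list_prod_rec[OF A d ys(1,2)]
    by (auto simp: inversion_at_def)
qed

text \<open>The shift \<open>W_d\<close> is the value at \<open>Suc d\<close>; starting from 0 makes
  \<open>P\<close> itself the first member.\<close>

definition horner_shift :: "nat \<Rightarrow> nat \<Rightarrow> (nat \<Rightarrow> complex mat) \<Rightarrow> nat \<Rightarrow> complex poly mat" where
  "horner_shift n m A k = matrix_polynomial n (m - k) (\<lambda>j. A (k + j))"

lemma horner_shift_carrier [simp]: "horner_shift n m A k \<in> carrier_mat n n"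
  by (simp add: horner_shift_def matrix_polynomial_def)

lemma horner_shift_rec:
  assumes "k < m" "A k \<in> carrier_mat n n"
  shows "horner_shift n m A k = [:0, 1:] \<cdot>\<^sub>m horner_shift n m A (Suc k) + const_poly_mat (A k)"
proof (rule eq_matI)
  obtain p where p: "m - k = Suc p" "m - Suc k = p" using assms(1) by (metis Suc_diff_Suc)
  fix i j
  assume "i < dim_row ([:0, 1:] \<cdot>\<^sub>m horner_shift n m A (Suc k) + const_poly_mat (A k))"
    "j < dim_col ([:0, 1:] \<cdot>\<^sub>m horner_shift n m A (Suc k) + const_poly_mat (A k))"
  then have ij: "i < n" "j < n" using assms(2) by auto
  have "(\<Sum>l\<le>Suc p. monom (A (k + l) $$ (i, j)) l) =
      [:0, 1:] * (\<Sum>l\<le>p. monom (A (Suc k + l) $$ (i, j)) l) + [:A k $$ (i, j):]"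
    unfolding sum.atMost_Suc_shift by (simp add: monom_Suc monom_0 sum_distrib_left)
  then show "horner_shift n m A k $$ (i, j) =
      ([:0, 1:] \<cdot>\<^sub>m horner_shift n m A (Suc k) + const_poly_mat (A k)) $$ (i, j)"
    using ij assms(2) by (simp add: horner_shift_def matrix_polynomial_def p)
qed (use assms in \<open>auto simp: horner_shift_def matrix_polynomial_def\<close>)

lemma horner_shift_last: "A m \<in> carrier_mat n n \<Longrightarrow> horner_shift n m A m = const_poly_mat (A m)"
  by (rule eq_matI) (auto simp: horner_shift_def matrix_polynomial_def monom_0)

text \<open>A linearization needs its state block in the form of a pencil, so the minus sign is
  absorbed into the coefficients.\<close>

lemma uminus_matrix_pencil:
  "L1 \<in> carrier_mat N N \<Longrightarrow> L0 \<in> carrier_mat N N \<Longrightarrow>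
    - matrix_pencil L1 (- L0) = matrix_pencil (- L1) L0"
  by (rule eq_matI) (auto simp: matrix_pencil_def)

text \<open>Specializes \<open>block_reduction\<close>: the products over the indices up to
  \<open>k\<close>, taken in the order of \<open>\<sigma>\<close>, satisfy its recursion, and the
  last Horner shift is the constant \<open>A m\<close>.\<close>

lemma fiedler_reduction:
  fixes m n :: nat and A :: "nat \<Rightarrow> complex mat" and \<sigma> :: "nat \<Rightarrow> nat"
  assumes m: "m = Suc d"
    and A: "\<And>j. j \<le> m \<Longrightarrow> A j \<in> carrier_mat n n"
    and BC: "B \<in> carrier_mat n r" "C \<in> carrier_mat n s"
    and \<sigma>: "bij_betw \<sigma> {0..<m} {1..m}"
  shows "\<exists>U V. U \<in> carrier_mat (m * n) (m * n) \<and> V \<in> carrier_mat (m * n) (m * n) \<and>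
    unimodular_poly_mat U \<and> unimodular_poly_mat V \<and>
    U * (- fiedler_pencil n m A \<sigma>) = diag2 (1\<^sub>m (d * n)) (- matrix_polynomial n m A) * V \<and>
    U * block_col d (initial_run (inversion_at \<sigma>) d) B = block_col d 0 B \<and>
    transpose_mat V * block_col d 0 C = block_col d (initial_run (\<lambda>e. \<not> inversion_at \<sigma> e) d) C"
    and "fiedler_mat n m A m \<in> carrier_mat (m * n) (m * n)"
    and "fiedler_prod n m A \<sigma> \<in> carrier_mat (m * n) (m * n)"
proof -
  \<comment> \<open>The indices in the order in which their factors occur in the product.\<close>
  define xs where "xs = map (the_inv_into {0..<m} \<sigma>) [1..<Suc m]"
  have inj: "inj_on \<sigma> {0..<m}" and img: "\<sigma> ` {0..<m} = {1..m}" using \<sigma> by (auto simp: bij_betw_def)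
  have inv_bij: "bij_betw (the_inv_into {0..<m} \<sigma>) {1..m} {0..<m}"
    using \<sigma> by (rule bij_betw_the_inv_into)
  have set_upt: "set [1..<Suc m] = {1..m}" by auto
  have set: "set xs = {0..<m}"
    unfolding xs_def set_map set_upt using inv_bij by (auto simp: bij_betw_def)
  have dist: "distinct xs"
    unfolding xs_def distinct_map set_upt using inv_bij by (auto simp: bij_betw_def)
  have \<sigma>_inv: "\<sigma> (the_inv_into {0..<m} \<sigma> k) = k" if "k \<in> {1..m}" for k
    using that img inj by (intro f_the_inv_into_f) auto
  have sorted: "sorted_wrt (\<lambda>i j. \<sigma> i < \<sigma> j) xs"
    unfolding xs_def sorted_wrt_map
    by (rule sorted_wrt_mono_rel[of _ "(<)"]) (auto simp: \<sigma>_inv simp del: upt_Suc)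
  have A': "\<And>i. i < m \<Longrightarrow> A i \<in> carrier_mat n n" using A by auto
  define F where "F k = fiedler_list_prod n (Suc k) A (filter (\<lambda>i. i < Suc k) xs)" for k
  have F: "F k \<in> carrier_mat (n + k * n) (n + k * n)" if "k \<le> d" for k
    using fiedler_list_prod_carrier[of m A n "filter (\<lambda>i. i < Suc k) xs" "Suc k", OF A'] that m
    by (simp add: F_def)
  have F_rec: "F (Suc k) = (if inversion_at \<sigma> k then fiedler_block n k (A (Suc k)) * diag2 (1\<^sub>m n) (F k)
      else diag2 (1\<^sub>m n) (F k) * fiedler_block n k (A (Suc k)))" if "k < d" for k
    unfolding F_def using that m by (intro fiedler_list_prod_filter_rec[OF A' sorted dist set]) auto
  have prod: "fiedler_prod n m A \<sigma> = F d"
  proof -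
    have "filter (\<lambda>i. i < Suc d) xs = xs" using set m by (auto intro!: filter_True)
    then show ?thesis
      by (simp add: F_def fiedler_prod_def fiedler_list_prod_def xs_def m foldr_map comp_def)
  qed
  show prod_carrier: "fiedler_prod n m A \<sigma> \<in> carrier_mat (m * n) (m * n)"
    using F[of d] by (simp add: prod m[symmetric]) (simp add: m)
  have lead: "fiedler_mat n m A m = diag2 (A m) (1\<^sub>m (d * n))"
  proof -
    have "diag2 X (0\<^sub>m 0 0) = X" for X :: "complex mat" by (rule eq_matI) auto
    then show ?thesis by (simp add: fiedler_mat_def m diag_block_mat_Cons_eq del: diag_block_mat.simps(2))
  qed
  show lead_carrier: "fiedler_mat n m A m \<in> carrier_mat (m * n) (m * n)"
  proof -
    have "diag2 (A m) (1\<^sub>m (d * n)) \<in> carrier_mat (n + d * n) (n + d * n)" using A[of m] by auto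
    then show ?thesis unfolding lead by (simp add: m)
  qed
  define Fp where "Fp k = const_poly_mat (F k)" for k
  define W where "W k = horner_shift n m A (Suc k)" for k
  have F_0: "Fp 0 = - const_poly_mat (A 0)"
  proof -
    have "filter (\<lambda>i. i < Suc 0) xs = [0]"
    proof -
      have s0: "set (filter (\<lambda>i. i < Suc 0) xs) = {0}" using set m by auto
      have "distinct (filter (\<lambda>i. i < Suc 0) xs)" using dist by simp
      then have "length (filter (\<lambda>i. i < Suc 0) xs) = 1" using s0 distinct_card by fastforce
      then obtain y where y: "filter (\<lambda>i. i < Suc 0) xs = [y]"
        by (metis One_nat_def length_0_conv length_Suc_conv)
      then show ?thesis using s0[unfolded y] by simp
    qed
    moreover have "diag2 (1\<^sub>m 0) X = X" "diag2 X (0\<^sub>m 0 0) = X" for X :: "complex mat"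
      by (rule eq_matI; simp)+
    ultimately have "F 0 = - A 0" using A[of 0]
      by (simp add: F_def fiedler_list_prod_def fiedler_mat_def diag_block_mat_Cons_eq one_mat_simps
          del: diag_block_mat.simps(2))
    then show ?thesis by (simp add: Fp_def const_poly_mat_uminus)
  qed
  have Fp_rec: "Fp (Suc k) = (if inversion_at \<sigma> k
      then fiedler_block n k (const_poly_mat (A (Suc k))) * diag2 (1\<^sub>m n) (Fp k)
      else diag2 (1\<^sub>m n) (Fp k) * fiedler_block n k (const_poly_mat (A (Suc k))))" if "k < d" for k
  proof -
    have Ak: "A (Suc k) \<in> carrier_mat n n" using A that m by auto
    note const_poly_mat_fiedler_block[OF Ak]
    moreover have "dim_row (fiedler_block n k (A (Suc k))) = n + (n + k * n)"
      "dim_col (fiedler_block n k (A (Suc k))) = n + (n + k * n)"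
      using Ak by (simp_all add: fiedler_block_def Let_def)
    moreover have "dim_row (F k) = n + k * n" "dim_col (F k) = n + k * n" using F[of k] that by auto
    ultimately show ?thesis
      by (simp add: Fp_def F_rec[OF that] const_poly_mat_mult const_poly_mat_diag2)
  qed
  \<comment> \<open>At \<open>d\<close> the Horner shift is the leading coefficient, so the last
    pencil of the reduction is the Fiedler pencil.\<close>
  have pencil: "- fiedler_pencil n m A \<sigma> = - ([:0, 1:] \<cdot>\<^sub>m diag2 (W d) (1\<^sub>m (d * n)) - Fp d)"
  proof -
    have "W d = const_poly_mat (A m)" unfolding W_def m[symmetric] using A by (intro horner_shift_last) auto
    then have "[:0, 1:] \<cdot>\<^sub>m diag2 (W d) (1\<^sub>m (d * n)) = [:0, 1:] \<cdot>\<^sub>m const_poly_mat (fiedler_mat n m A m)"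
      by (simp add: lead const_poly_mat_diag2)
    moreover have "fiedler_pencil n m A \<sigma> = [:0, 1:] \<cdot>\<^sub>m const_poly_mat (fiedler_mat n m A m) - Fp d"
      unfolding fiedler_pencil_def matrix_pencil_def prod Fp_def const_poly_mat_uminus
      using prod_carrier lead_carrier unfolding prod by (intro eq_matI) auto
    ultimately show ?thesis by simp
  qed
  have poly: "matrix_polynomial n m A = [:0, 1:] \<cdot>\<^sub>m W 0 + const_poly_mat (A 0)"
    using horner_shift_rec[of 0 m A n] A[of 0] m by (simp add: W_def horner_shift_def)
  have W_rec: "W k = [:0, 1:] \<cdot>\<^sub>m W (Suc k) + const_poly_mat (A (Suc k))" if "k < d" for k
    unfolding W_def using A that m by (intro horner_shift_rec) auto
  show "\<exists>U V. U \<in> carrier_mat (m * n) (m * n) \<and> V \<in> carrier_mat (m * n) (m * n) \<and>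
    unimodular_poly_mat U \<and> unimodular_poly_mat V \<and>
    U * (- fiedler_pencil n m A \<sigma>) = diag2 (1\<^sub>m (d * n)) (- matrix_polynomial n m A) * V \<and>
    U * block_col d (initial_run (inversion_at \<sigma>) d) B = block_col d 0 B \<and>
    transpose_mat V * block_col d 0 C = block_col d (initial_run (\<lambda>e. \<not> inversion_at \<sigma> e) d) C"
    unfolding pencil poly unfolding m mult_Suc
  proof (rule block_reduction[where M = d, OF _ _ _ W_rec F_0 Fp_rec BC order_refl])
    show "W k \<in> carrier_mat n n" for k by (simp add: W_def)
    show "const_poly_mat (A k) \<in> carrier_mat n n" if "k \<le> d" for k using A that m by simp
    show "Fp k \<in> carrier_mat (n + k * n) (n + k * n)" if "k \<le> d" for k using F[OF that] by (simp add: Fp_def)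
  qed
qed

theorem theorem3p3:
  fixes m n r :: nat
    and A :: "nat \<Rightarrow> complex mat"
    and B C D :: "complex mat"
    and \<sigma> :: "nat \<Rightarrow> nat"
    and c1 i1 :: nat
    and ps :: "(nat \<times> nat) list"
  assumes "m \<ge> 1"
    and "\<And>j. j \<le> m \<Longrightarrow> A j \<in> carrier_mat n n"
    and "regular_poly_mat (matrix_polynomial n m A)"
    and "B \<in> carrier_mat n r"
    and "C \<in> carrier_mat r n"
    and "D \<in> carrier_mat r r"
    and "bij_betw \<sigma> {0..<m} {1..m}"
    and "is_CISS m \<sigma> ((c1, i1) # ps)"
  shows "system_linearization m n r D
           (poly_system n m A B C D) (fiedler_system_pencil n m A B C D \<sigma> c1 i1)
    \<and> strict_system_equivalent r r
           n (poly_system n m A B C D) (m * n) (fiedler_system_pencil n m A B C D \<sigma> c1 i1)"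
proof -
  obtain d where m: "m = Suc d" using assms(1) by (cases m) auto
  note A = assms(2) and B = assms(4) and C = assms(5) and D = assms(6)
  \<comment> \<open>Block rows of the input and the output block, counted from 0 at the
    bottom.\<close>
  define b c where "b = initial_run (inversion_at \<sigma>) d" and "c = initial_run (\<lambda>e. \<not> inversion_at \<sigma> e) d"
  have bc: "b \<le> d" "c \<le> d" by (simp_all add: b_def c_def initial_run_le)
  have bc_ciss: "if c1 > 0 then b = 0 \<and> c = c1 else b = i1 \<and> c = 0"
    using is_CISS_initial_run[OF assms(8) m] by (simp add: b_def c_def)
  let ?L = "- fiedler_pencil n m A \<sigma>" and ?P = "- matrix_polynomial n m A"
  define X Y where "X = e_col m (m - b) \<otimes>\<^sub>K B" and "Y = transpose_mat (e_col m (m - c)) \<otimes>\<^sub>K C"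
  \<comment> \<open>Row 0 from the bottom is \<open>e_col m m\<close>, so \<open>m - b\<close> and
    \<open>m - c\<close> describe both branches of the definition.\<close>
  have T: "fiedler_system_pencil n m A B C D \<sigma> c1 i1 =
      four_block_mat ?L (const_poly_mat X) (const_poly_mat Y) (const_poly_mat D)"
    using bc_ciss by (auto simp: fiedler_system_pencil_def X_def Y_def split: if_splits)
  have X: "const_poly_mat X = block_col d b (const_poly_mat B)"
    unfolding X_def m using bc by (intro const_poly_mat_kronecker_e_col)
  have Y: "transpose_mat (const_poly_mat Y) = block_col d c (const_poly_mat (transpose_mat C))"
    unfolding Y_def transpose_const_poly_mat transpose_kronecker_e_col transpose_transpose m
    using bc by (intro const_poly_mat_kronecker_e_col)
  have carr_XY: "X \<in> carrier_mat (m * n) r" "Y \<in> carrier_mat r (m * n)"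
    using B C unfolding X_def Y_def by (auto simp: kronecker_def e_col_def intro!: carrier_matI)
  have "const_poly_mat B \<in> carrier_mat n r" "const_poly_mat (transpose_mat C) \<in> carrier_mat n r"
    using B C by simp_all
  note reduction = fiedler_reduction[where A = A and n = n, OF m A this assms(7)]
  from reduction(1) obtain U V where U: "U \<in> carrier_mat (m * n) (m * n)" "unimodular_poly_mat U"
    and V: "V \<in> carrier_mat (m * n) (m * n)" "unimodular_poly_mat V"
    and UL: "U * ?L = diag2 (1\<^sub>m (d * n)) ?P * V"
    and UB: "U * block_col d b (const_poly_mat B) = block_col d 0 (const_poly_mat B)"
    and VC: "transpose_mat V * block_col d 0 (const_poly_mat (transpose_mat C)) = block_col d c (const_poly_mat (transpose_mat C))"
    unfolding b_def c_def by blast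
  have L: "?L = matrix_pencil (- fiedler_mat n m A m) (fiedler_prod n m A \<sigma>)"
    unfolding fiedler_pencil_def by (rule uminus_matrix_pencil[OF reduction(2,3)])
  have L_carrier: "?L \<in> carrier_mat (m * n) (m * n)"
    unfolding L matrix_pencil_def using reduction(2,3) by simp
  have P: "?P \<in> carrier_mat n n" by (simp add: matrix_polynomial_def)
  have det: "det ?P \<noteq> 0"
  proof -
    have "?P = (- 1) \<cdot>\<^sub>m matrix_polynomial n m A" by (rule eq_matI) auto
    then show ?thesis using assms(3) by (simp add: regular_poly_mat_def det_smult)
  qed
  \<comment> \<open>Entries of degree at most 1 bound the degree of the determinant by the size, as
    the choice \<open>q = m * n\<close> requires.\<close>
  have "degree (?L $$ (i, j)) \<le> 1" if "i < m * n" "j < m * n" for i j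
    unfolding L matrix_pencil_def using reduction(2,3) that
    by (simp add: degree_add_le)
  then have deg: "degree (det ?L) \<le> m * n"
    using degree_det_le[OF _ L_carrier, of 1] by (metis mult_1)
  have "strict_system_equivalent r r (m * n) (four_block_mat ?L (const_poly_mat X) (const_poly_mat Y) (const_poly_mat D))
      n (four_block_mat ?P (const_poly_mat B) (const_poly_mat C) (const_poly_mat D))"
  proof (rule strict_system_equivalentI[OF L_carrier P _ det deg _ _ _ _ _ U V UL])
    show "m * n = d * n + n" by (simp add: m)
    show "U * const_poly_mat X = 0\<^sub>m (d * n) r @\<^sub>r const_poly_mat B"
      unfolding X UB block_col_0_eq using B by simp
    show "transpose_mat V * (0\<^sub>m (d * n) r @\<^sub>r transpose_mat (const_poly_mat C)) = transpose_mat (const_poly_mat Y)"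
      unfolding Y unfolding VC[symmetric] block_col_0_eq transpose_const_poly_mat using C by simp
  qed (use carr_XY B C D in simp_all)
  then have eq: "strict_system_equivalent r r (m * n) (fiedler_system_pencil n m A B C D \<sigma> c1 i1)
      n (poly_system n m A B C D)"
    unfolding T poly_system_def .
  moreover have "system_linearization m n r D (poly_system n m A B C D) (fiedler_system_pencil n m A B C D \<sigma> c1 i1)"
    unfolding system_linearization_def
  proof (intro conjI exI)
    show "fiedler_system_pencil n m A B C D \<sigma> c1 i1 =
        four_block_mat (matrix_pencil (- fiedler_mat n m A m) (fiedler_prod n m A \<sigma>))
          (const_poly_mat X) (const_poly_mat Y) (const_poly_mat D)"
      unfolding T L ..
  qed (use carr_XY reduction(2,3) eq in simp_all)
  \<comment> \<open>The linearization is stated from the pencil to the system; symmetry gives the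
    other direction.\<close>
  ultimately show ?thesis using strict_system_equivalent_sym by blast
qed

end
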